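(* There exists a minimal Toeplitz subshift whose automorphism group is not finitely generated.
   Context: Let $S$ be a finite alphabet with the discrete topology and give $S^{\mathbb{Z}}$ the product topology. The shift map is $\sigma(x)_i = x_{i+1}$. A subshift is a topologically closed $X \subset S^{\mathbb{Z}}$ with $\sigma(X) = X$; it is minimal if it contains no nonempty proper subshift. A Toeplitz point is $x \in S^{\mathbb{Z}}$ such that for every $i \in \mathbb{Z}$ there is $p > 0$ with $x_{i+kp} = x_i$ for all $k \in \mathbb{Z}$. A Toeplitz subshift is the orbit closure $\overline{\{\sigma^i(x) \mid i \in \mathbb{Z}\}}$ of a Toeplitz point $x$. An automorphism of $X$ is a homeomorphism $f : X \to X$ with $f \circ \sigma = \sigma \circ f$; the automorphisms form a group under composition. *)

theory Defs
  imports
    "HOL-Analysis.Analysis"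
    "HOL-Algebra.Bij"
    "HOL-Algebra.Generated_Groups"
begin

definition full_shift :: "'a set \<Rightarrow> (int \<Rightarrow> 'a) topology"
  where "full_shift S = product_topology (\<lambda>_. discrete_topology S) UNIV"

definition shift :: "(int \<Rightarrow> 'a) \<Rightarrow> int \<Rightarrow> 'a"
  where "shift x = (\<lambda>i. x (i + 1))"

text \<open>Integer powers of the shift in closed form; the three lemmas below characterise them.\<close>

definition shift_pow :: "int \<Rightarrow> (int \<Rightarrow> 'a) \<Rightarrow> int \<Rightarrow> 'a"
  where "shift_pow k x = (\<lambda>i. x (i + k))"

lemma shift_pow_0: "shift_pow 0 = id"
  by (auto simp: shift_pow_def fun_eq_iff)

lemma shift_pow_1: "shift_pow 1 = shift"
  by (auto simp: shift_pow_def shift_def fun_eq_iff)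

lemma shift_pow_add: "shift_pow (k + l) = shift_pow k \<circ> shift_pow l"
  by (auto simp: shift_pow_def fun_eq_iff add_ac)

definition subshift :: "'a set \<Rightarrow> (int \<Rightarrow> 'a) set \<Rightarrow> bool"
  where "subshift S X \<longleftrightarrow> closedin (full_shift S) X \<and> shift ` X = X"

definition minimal_subshift :: "'a set \<Rightarrow> (int \<Rightarrow> 'a) set \<Rightarrow> bool"
  where "minimal_subshift S X \<longleftrightarrow>
    subshift S X \<and> \<not> (\<exists>Y. subshift S Y \<and> Y \<noteq> {} \<and> Y \<subset> X)"

definition toeplitz_point :: "'a set \<Rightarrow> (int \<Rightarrow> 'a) \<Rightarrow> bool"
  where "toeplitz_point S x \<longleftrightarrow>
    x \<in> topspace (full_shift S) \<and> (\<forall>i. \<exists>p>0::int. \<forall>k. x (i + k * p) = x i)"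

definition toeplitz_subshift :: "'a set \<Rightarrow> (int \<Rightarrow> 'a) set \<Rightarrow> bool"
  where "toeplitz_subshift S X \<longleftrightarrow>
    (\<exists>x. toeplitz_point S x \<and> X = (full_shift S) closure_of {shift_pow i x | i. True})"

definition shift_automorphisms :: "'a set \<Rightarrow> (int \<Rightarrow> 'a) set \<Rightarrow> ((int \<Rightarrow> 'a) \<Rightarrow> int \<Rightarrow> 'a) set"
  where "shift_automorphisms S X =
    {f \<in> extensional X.
      homeomorphic_map (subtopology (full_shift S) X) (subtopology (full_shift S) X) f \<and>
      (\<forall>x\<in>X. f (shift x) = shift (f x))}"

text \<open>Automorphisms are made extensional on \<^term>\<open>X\<close>, so that equality of functions is
  equality on \<^term>\<open>X\<close>; the product is that of \<^const>\<open>BijGroup\<close>, i.e. composition.\<close>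

definition shift_aut_group :: "'a set \<Rightarrow> (int \<Rightarrow> 'a) set \<Rightarrow> ((int \<Rightarrow> 'a) \<Rightarrow> int \<Rightarrow> 'a) monoid"
  where "shift_aut_group S X = (BijGroup X) \<lparr>carrier := shift_automorphisms S X\<rparr>"

definition finitely_generated_group :: "('g, 'b) monoid_scheme \<Rightarrow> bool"
  where "finitely_generated_group G \<longleftrightarrow>
    (\<exists>A. finite A \<and> A \<subseteq> carrier G \<and> generate G A = carrier G)"

lemma topspace_full_shift: "topspace (full_shift S) = {x. \<forall>i. x i \<in> S}"
  by (auto simp: full_shift_def PiE_def)

lemma topspace_subshift:
  assumes "subshift S X"
  shows "topspace (subtopology (full_shift S) X) = X"
  using assms by (meson closedin_subset subshift_def topspace_subtopology_subset)

lemma subgroup_shift_automorphisms: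
  assumes "subshift S X"
  shows "subgroup (shift_automorphisms S X) (BijGroup X)"
proof -
  interpret group "BijGroup X" by (rule group_BijGroup)
  define T where "T = subtopology (full_shift S) X"
  have T: "topspace T = X"
    unfolding T_def by (rule topspace_subshift[OF assms])
  have sX: "shift x \<in> X" if "x \<in> X" for x
    using assms that unfolding subshift_def by blast
  have aut: "f \<in> shift_automorphisms S X \<longleftrightarrow>
      f \<in> extensional X \<and> homeomorphic_map T T f \<and> (\<forall>x\<in>X. f (shift x) = shift (f x))" for f
    unfolding shift_automorphisms_def T_def by blast
  have autB: "f \<in> Bij X" and autbij: "bij_betw f X X" if "f \<in> shift_automorphisms S X" for f
  proof -
    have h: "homeomorphic_map T T f" "f \<in> extensional X"
      using that by (simp_all add: aut)
    show "bij_betw f X X"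
      using homeomorphic_imp_injective_map[OF h(1)] homeomorphic_imp_surjective_map[OF h(1)]
      unfolding T bij_betw_def by blast
    then show "f \<in> Bij X" using h by (simp add: Bij_def)
  qed
  show ?thesis
  proof (rule subgroupI)
    show "shift_automorphisms S X \<subseteq> carrier (BijGroup X)"
      unfolding BijGroup_def using autB by (simp add: subset_iff)
    have "homeomorphic_map T T id" by simp
    then have "homeomorphic_map T T (\<lambda>x\<in>X. x)"
      by (rule homeomorphic_map_eq) (simp add: T)
    then have "(\<lambda>x\<in>X. x) \<in> shift_automorphisms S X"
      by (simp add: aut sX)
    then show "shift_automorphisms S X \<noteq> {}" by blast
  next
    fix f assume f: "f \<in> shift_automorphisms S X"
    let ?g = "restrict (inv_into X f) X"
    note b = autbij[OF f]
    have "homeomorphic_map T T ?g"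
    proof -
      obtain g where g: "homeomorphic_maps T T f g"
        using f unfolding aut homeomorphic_map_maps by blast
      then have "homeomorphic_map T T g"
        using homeomorphic_maps_map by blast
      moreover have "g x = ?g x" if "x \<in> topspace T" for x
      proof -
        have "g x \<in> X" "f (g x) = x"
          using g that unfolding homeomorphic_maps_def continuous_map_def T by blast+
        then show ?thesis
          using bij_betw_inv_into_left[OF b, of "g x"] that by (simp add: T)
      qed
      ultimately show ?thesis
        by (rule homeomorphic_map_eq)
    qed
    moreover have "?g (shift x) = shift (?g x)" if "x \<in> X" for x
    proof -
      have "x \<in> f ` X" using bij_betw_imp_surj_on[OF b] that by simp
      then obtain y where y: "y \<in> X" "x = f y" by blast
      then have "shift x = f (shift y)"
        using f by (simp add: aut)
      then show ?thesis
        using bij_betw_inv_into_left[OF b y(1)] bij_betw_inv_into_left[OF b sX[OF y(1)]]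
          sX[OF that] that y(2) by simp
    qed
    ultimately have "?g \<in> shift_automorphisms S X"
      by (simp add: aut)
    then show "inv\<^bsub>BijGroup X\<^esub> f \<in> shift_automorphisms S X"
      using inv_BijGroup[OF autB[OF f]] by simp
  next
    fix f g assume f: "f \<in> shift_automorphisms S X" and g: "g \<in> shift_automorphisms S X"
    have "homeomorphic_map T T (f \<circ> g)"
      using f g unfolding aut by (blast intro: homeomorphic_map_compose)
    then have "homeomorphic_map T T (compose X f g)"
      by (rule homeomorphic_map_eq) (simp add: T compose_def)
    moreover have "g x \<in> X" if "x \<in> X" for x
      using bij_betwE[OF autbij[OF g]] that by blast
    ultimately have "compose X f g \<in> shift_automorphisms S X"
      using f g sX by (simp add: aut compose_def)
    then show "f \<otimes>\<^bsub>BijGroup X\<^esub> g \<in> shift_automorphisms S X"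
      using autB[OF f] autB[OF g] by (simp add: BijGroup_def)
  qed
qed

lemma group_shift_aut_group: "subshift S X \<Longrightarrow> group (shift_aut_group S X)"
  unfolding shift_aut_group_def
  by (rule subgroup.subgroup_is_group[OF subgroup_shift_automorphisms group_BijGroup])

end

theory Submission
  imports Defs
begin

text \<open>
  The sequence \<open>x\<close> is the one with \<open>x (5 m) = 1\<close>, \<open>x (5 m \<plusminus> 1) = 0\<close> whose restriction to the
  remaining positions (the holes), read from left to right, is \<open>x\<close> again. With the hole next to
  the right of the origin numbered \<open>0\<close>, the number of a hole is smaller in absolute value than its
  position, so every position is eventually filled and \<open>x\<close> is a Toeplitz point. Every point \<open>y\<close> of
  its orbit closure \<open>X\<close> has a unique phase modulo \<open>5\<close>, and reading its holes gives another point
  of \<open>X\<close>. So an automorphism \<open>f\<close> can be applied to the holes only, which yields an automorphism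
  \<open>lift f\<close>. A shift by \<open>5\<close> shifts the holes by \<open>2\<close>, hence \<open>lift (\<sigma>\<^sup>2) = \<sigma>\<^sup>5\<close>, and iterated lifts of
  \<open>\<sigma>\<close> give automorphisms whose \<open>2 ^ n\<close>-th power is \<open>\<sigma>\<close> to the power \<open>5 ^ n\<close>; their order modulo
  \<open>\<langle>\<sigma>\<rangle>\<close> is unbounded. The automorphism group is abelian because an automorphism is determined by
  the translation it induces on the phases modulo \<open>5 ^ n\<close>. In a finitely generated abelian group
  the orders of the torsion elements modulo a subgroup are bounded.
\<close>

section \<open>The topology of the full shift\<close>

lemma shift_pow_apply [simp]: "shift_pow k x i = x (i + k)"
  by (simp add: shift_pow_def)

lemma shift_pow_shift_pow [simp]: "shift_pow k (shift_pow l x) = shift_pow (k + l) x"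
  by (simp add: shift_pow_add)

lemma shift_pow_zero [simp]: "shift_pow 0 x = x"
  by (simp add: shift_pow_0)

text \<open>Central windows form a neighbourhood base at each point of the product topology; all
  topological notions below are reduced to them. For negative \<open>N\<close> the relation always
  holds.\<close>

definition agree :: "int \<Rightarrow> (int \<Rightarrow> 'a) \<Rightarrow> (int \<Rightarrow> 'a) \<Rightarrow> bool"
  where "agree N y z \<longleftrightarrow> (\<forall>i. \<bar>i\<bar> \<le> N \<longrightarrow> y i = z i)"

lemma agreeD: "agree N y z \<Longrightarrow> \<bar>i\<bar> \<le> N \<Longrightarrow> y i = z i"
  by (simp add: agree_def)

lemma agree_mono: "agree N y z \<Longrightarrow> M \<le> N \<Longrightarrow> agree M y z"
  by (simp add: agree_def)

lemma agree_shift_pow: "agree (N + \<bar>k\<bar>) y z \<Longrightarrow> agree N (shift_pow k y) (shift_pow k z)"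
  by (simp add: agree_def)

text \<open>A basic open box restricts finitely many coordinates, which fit into one central window;
  conversely, prescribing a central window is itself such a box.\<close>

lemma openin_subtopology_full_shift:
  assumes "X \<subseteq> topspace (full_shift S)"
  shows "openin (subtopology (full_shift S) X) U \<longleftrightarrow>
    U \<subseteq> X \<and> (\<forall>x\<in>U. \<exists>N. \<forall>y\<in>X. agree N x y \<longrightarrow> y \<in> U)"
proof (intro iffI conjI ballI)
  assume U: "openin (subtopology (full_shift S) X) U"
  then show "U \<subseteq> X" using openin_subset by fastforce
  fix x assume x: "x \<in> U"
  obtain T where T: "openin (full_shift S) T" "U = T \<inter> X"
    using U unfolding openin_subtopology by blast
  then obtain V where V: "finite {i. V i \<noteq> S}" "x \<in> Pi\<^sub>E UNIV V" "Pi\<^sub>E UNIV V \<subseteq> T"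
    using x unfolding full_shift_def openin_product_topology_alt by auto
  obtain N where N: "\<And>i. V i \<noteq> S \<Longrightarrow> \<bar>i\<bar> \<le> N"
    using V(1) by (metis (mono_tags) Max_ge finite_imageI imageI mem_Collect_eq)
  have "y \<in> U" if "y \<in> X" "agree N x y" for y
  proof -
    have "y i \<in> V i" for i
    proof (cases "V i = S")
      case True
      then show ?thesis using that(1) assms by (auto simp: topspace_full_shift)
    next
      case False
      then have "y i = x i" using N that(2) by (simp add: agree_def)
      then show ?thesis using V(2) by (simp add: PiE_iff)
    qed
    then show ?thesis using V(3) T(2) that by (auto simp: PiE_iff)
  qed
  then show "\<exists>N. \<forall>y\<in>X. agree N x y \<longrightarrow> y \<in> U" by blast
next
  assume U: "U \<subseteq> X \<and> (\<forall>x\<in>U. \<exists>N. \<forall>y\<in>X. agree N x y \<longrightarrow> y \<in> U)"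
  then obtain N where N: "\<And>x y. x \<in> U \<Longrightarrow> y \<in> X \<Longrightarrow> agree (N x) x y \<Longrightarrow> y \<in> U" by metis
  define T where "T = (\<Union>x\<in>U. {y \<in> topspace (full_shift S). agree (N x) x y})"
  have "openin (full_shift S) {y \<in> topspace (full_shift S). agree M x y}" for M x
  proof -
    have "{y \<in> topspace (full_shift S). agree M x y} =
        Pi\<^sub>E UNIV (\<lambda>i. if \<bar>i\<bar> \<le> M then S \<inter> {x i} else S)"
      by (auto simp: agree_def topspace_full_shift PiE_iff split: if_splits)
    moreover have "finite {i. (if \<bar>i\<bar> \<le> M then S \<inter> {x i} else S) \<noteq> S}"
      by (rule finite_subset[of _ "{- M..M}"]) (auto split: if_splits)
    ultimately show ?thesis
      by (simp add: full_shift_def openin_PiE_gen)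
  qed
  then have "openin (full_shift S) T" unfolding T_def by blast
  moreover have "U = T \<inter> X"
  proof
    show "U \<subseteq> T \<inter> X"
      using U assms by (force simp: T_def agree_def)
    show "T \<inter> X \<subseteq> U"
      unfolding T_def using N by blast
  qed
  ultimately show "openin (subtopology (full_shift S) X) U"
    unfolding openin_subtopology by blast
qed

lemma in_closure_full_shift:
  assumes "A \<subseteq> topspace (full_shift S)"
  shows "y \<in> (full_shift S) closure_of A \<longleftrightarrow>
    y \<in> topspace (full_shift S) \<and> (\<forall>N. \<exists>a\<in>A. agree N y a)" (is "_ = ?R")
proof -
  note op = openin_subtopology_full_shift[OF subset_refl, of S, unfolded subtopology_topspace]
  show ?thesis
  proof
    assume y: "y \<in> (full_shift S) closure_of A"
    have "\<exists>a\<in>A. agree N y a" for N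
    proof -
      have "openin (full_shift S) {z \<in> topspace (full_shift S). agree N y z}"
        unfolding op by (auto simp: agree_def intro!: exI[of _ N])
      moreover have "y \<in> {z \<in> topspace (full_shift S). agree N y z}"
        using y by (simp add: in_closure_of agree_def)
      ultimately have "\<exists>a\<in>A. a \<in> {z \<in> topspace (full_shift S). agree N y z}"
        using y by (metis (lifting) in_closure_of)
      then show ?thesis by blast
    qed
    then show ?R using y by (simp add: in_closure_of)
  next
    assume R: ?R
    have "\<exists>a. a \<in> A \<and> a \<in> T" if T: "y \<in> T" "openin (full_shift S) T" for T
    proof -
      obtain N where "\<And>z. z \<in> topspace (full_shift S) \<Longrightarrow> agree N y z \<Longrightarrow> z \<in> T"
        using T op[of T] by metis
      then show ?thesis using R assms by (metis subsetD)
    qed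
    then show "y \<in> (full_shift S) closure_of A"
      using R by (simp add: in_closure_of)
  qed
qed

lemma continuous_map_full_shift:
  assumes "X \<subseteq> topspace (full_shift S)"
  shows "continuous_map (subtopology (full_shift S) X) (subtopology (full_shift S) X) f \<longleftrightarrow>
    f \<in> X \<rightarrow> X \<and> (\<forall>y\<in>X. \<forall>M. \<exists>N. \<forall>z\<in>X. agree N y z \<longrightarrow> agree M (f y) (f z))"
proof -
  have top: "topspace (subtopology (full_shift S) X) = X"
    using assms by auto
  note op = openin_subtopology_full_shift[OF assms]
  show ?thesis
  proof (intro iffI conjI ballI allI)
    assume f: "continuous_map (subtopology (full_shift S) X) (subtopology (full_shift S) X) f"
    then show fX: "f \<in> X \<rightarrow> X" unfolding continuous_map_def top by blast
    fix y M assume y: "y \<in> X"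
    have "openin (subtopology (full_shift S) X) {z \<in> X. agree M (f y) z}"
      unfolding op by (auto simp: agree_def intro!: exI[of _ M])
    then have "openin (subtopology (full_shift S) X) {x \<in> X. f x \<in> {z \<in> X. agree M (f y) z}}"
      using f unfolding continuous_map_def top by blast
    moreover have "y \<in> {x \<in> X. f x \<in> {z \<in> X. agree M (f y) z}}"
      using y fX by (auto simp: agree_def)
    ultimately show "\<exists>N. \<forall>z\<in>X. agree N y z \<longrightarrow> agree M (f y) (f z)"
      unfolding op by (metis (mono_tags, lifting) mem_Collect_eq)
  next
    assume f: "f \<in> X \<rightarrow> X \<and>
      (\<forall>y\<in>X. \<forall>M. \<exists>N. \<forall>z\<in>X. agree N y z \<longrightarrow> agree M (f y) (f z))"
    show "continuous_map (subtopology (full_shift S) X) (subtopology (full_shift S) X) f"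
      unfolding continuous_map_def top
    proof (intro conjI allI impI)
      show "f \<in> X \<rightarrow> X" using f by blast
      fix U assume U: "openin (subtopology (full_shift S) X) U"
      show "openin (subtopology (full_shift S) X) {x \<in> X. f x \<in> U}"
        unfolding op
      proof (intro conjI ballI)
        fix x assume x: "x \<in> {x \<in> X. f x \<in> U}"
        then obtain M where M: "\<And>y. y \<in> X \<Longrightarrow> agree M (f x) y \<Longrightarrow> y \<in> U"
          using U unfolding op by blast
        obtain N where N: "\<And>z. z \<in> X \<Longrightarrow> agree N x z \<Longrightarrow> agree M (f x) (f z)"
          using f x by (metis (mono_tags, lifting) mem_Collect_eq)
        show "\<exists>N. \<forall>y\<in>X. agree N x y \<longrightarrow> y \<in> {x \<in> X. f x \<in> U}"
          using M N f by (intro exI[of _ N]) blast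
      qed blast
    qed
  qed
qed

section \<open>Finitely generated abelian groups\<close>

text \<open>Commutativity lets all powers of \<open>a\<close> in a word over
  \<open>insert a B\<close> be collected at its end.\<close>

lemma (in comm_group) generate_insert:
  assumes "a \<in> carrier G" "B \<subseteq> carrier G" and g: "g \<in> generate G (insert a B)"
  obtains h i where "h \<in> generate G B" "g = h \<otimes> a [^] (i::int)"
proof -
  have "\<exists>h\<in>generate G B. \<exists>i::int. g = h \<otimes> a [^] i"
    using g
  proof (induction rule: generate.induct)
    case one
    show ?case using generate.one by (force intro: exI[of _ 0])
  next
    case (incl h)
    show ?case
    proof (cases "h = a")
      case True
      then have "h = \<one> \<otimes> a [^] (1::int)" using assms by simp
      then show ?thesis using generate.one by blast
    next
      case False
      then have "h \<in> B" using incl by simp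
      then have "h \<in> generate G B" "h = h \<otimes> a [^] (0::int)" using assms by (auto intro: generate.incl)
      then show ?thesis by blast
    qed
  next
    case (inv h)
    show ?case
    proof (cases "h = a")
      case True
      then have "inv h = \<one> \<otimes> a [^] (-1::int)" using assms by (simp add: int_pow_neg)
      then show ?thesis using generate.one by blast
    next
      case False
      then have h: "h \<in> B" using inv by simp
      then have "inv h \<in> generate G B" "inv h = inv h \<otimes> a [^] (0::int)"
        using assms by (auto intro: generate.inv)
      then show ?thesis by blast
    qed
  next
    case (eng h1 h2)
    then obtain k1 k2 and i1 i2 :: int where k: "k1 \<in> generate G B" "k2 \<in> generate G B"
      "h1 = k1 \<otimes> a [^] i1" "h2 = k2 \<otimes> a [^] i2" by blast
    have c: "k1 \<in> carrier G" "k2 \<in> carrier G" using k assms generate_in_carrier by blast+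
    have "h1 \<otimes> h2 = (k1 \<otimes> k2) \<otimes> a [^] (i1 + i2)"
      using c assms by (simp add: k int_pow_mult m_ac)
    then show ?case using generate.eng[OF k(1,2)] by metis
  qed
  then show ?thesis using that by blast
qed

text \<open>For trivial \<open>K\<close> this says that the torsion of a finitely generated abelian group has
  bounded exponent.\<close>

lemma (in comm_group) bounded_exponent_modulo_subgroup:
  assumes "finite A" "A \<subseteq> carrier G" and K: "subgroup K G"
  shows "\<exists>M>0. \<forall>g\<in>generate G (A \<union> K). \<forall>n>0. g [^] (n::nat) \<in> K \<longrightarrow> g [^] (M::nat) \<in> K"
  using assms(1,2)
proof (induction A rule: finite_induct)
  case empty
  have "generate G K = K" using K generate_subgroup_incl[of K K] generate.incl[of _ K G] by blast
  then show ?case using subgroup.mem_carrier[OF K] by (intro exI[of _ "1::nat"]) simp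
next
  case (insert a A)
  define H where "H = generate G (A \<union> K)"
  have Kc: "K \<subseteq> carrier G" using K by (rule subgroup.subset)
  have a: "a \<in> carrier G" and A: "A \<union> K \<subseteq> carrier G" using insert Kc by auto
  have H: "subgroup H G" unfolding H_def using A by (rule generate_is_subgroup)
  have KH: "K \<subseteq> H" unfolding H_def using generate.incl[of _ "A \<union> K" G] by blast
  obtain M :: nat where M: "M > 0" "\<And>g n. g \<in> H \<Longrightarrow> n > 0 \<Longrightarrow> g [^] (n::nat) \<in> K \<Longrightarrow> g [^] M \<in> K"
    using insert H_def by auto
  have gen: "\<exists>h\<in>H. \<exists>i::int. g = h \<otimes> a [^] i" if "g \<in> generate G (insert a A \<union> K)" for g
    using generate_insert[OF a A, of g] that unfolding H_def Un_insert_left by metis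
  \<comment> \<open>The split is on whether \<open>a\<close> has finite order modulo
    \<open>H\<close>. If \<open>a [^] k\<close> lies in \<open>H\<close>, then so does
    \<open>g [^] k\<close>, and \<open>k * M\<close> works. Otherwise a power of \<open>g\<close> in
    \<open>K\<close>, hence in \<open>H\<close>, forces the exponent of \<open>a\<close> in
    \<open>g\<close> to vanish, so \<open>g\<close> lies in \<open>H\<close> and \<open>M\<close>
    still works.\<close>
  show ?case
  proof (cases "\<exists>k>0. a [^] (k::nat) \<in> H")
    case True
    then obtain k :: nat where k: "k > 0" "a [^] k \<in> H" by blast
    have "g [^] (k * M) \<in> K" if g: "g \<in> generate G (insert a A \<union> K)" and n: "n > 0" "g [^] n \<in> K"
      for g and n :: nat
    proof -
      obtain h i where h: "h \<in> H" "g = h \<otimes> a [^] (i::int)" using gen g by blast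
      have hc: "h \<in> carrier G" using subgroup.mem_carrier[OF H h(1)] .
      have gc: "g \<in> carrier G" using h hc a by simp
      have "(a [^] i) [^] k = (a [^] k) [^] i"
        by (simp only: int_pow_pow[OF a] mult.commute flip: int_pow_int)
      then have "g [^] k = h [^] k \<otimes> (a [^] k) [^] i"
        unfolding h(2) nat_pow_distrib[OF hc int_pow_closed[OF a]] by simp
      moreover have "h [^] k \<in> H" "(a [^] k) [^] i \<in> H"
        using subgroup_int_pow_closed[OF H h(1), of "int k"] subgroup_int_pow_closed[OF H k(2)]
        by (simp_all add: int_pow_int)
      ultimately have "g [^] k \<in> H" using H by (simp add: subgroup.m_closed)
      moreover have "(g [^] k) [^] n \<in> K"
      proof -
        have "(g [^] k) [^] n = (g [^] n) [^] k" using gc by (metis nat_pow_pow mult.commute)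
        also have "\<dots> \<in> K" using subgroup_int_pow_closed[OF K n(2), of "int k"] by (simp add: int_pow_int)
        finally show ?thesis .
      qed
      ultimately have "(g [^] k) [^] M \<in> K" using M n by blast
      then show ?thesis using gc by (simp add: nat_pow_pow)
    qed
    then show ?thesis using k M(1) by (intro exI[of _ "k * M"]) auto
  next
    case False
    have "g [^] M \<in> K" if g: "g \<in> generate G (insert a A \<union> K)" and n: "n > 0" "g [^] n \<in> K"
      for g and n :: nat
    proof -
      obtain h i where h: "h \<in> H" "g = h \<otimes> a [^] (i::int)" using gen g by blast
      have hc: "h \<in> carrier G" using subgroup.mem_carrier[OF H h(1)] .
      have "g [^] n = h [^] n \<otimes> a [^] (i * int n)"
        unfolding h(2) nat_pow_distrib[OF hc int_pow_closed[OF a]]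
        by (simp only: int_pow_pow[OF a] flip: int_pow_int)
      then have "a [^] (i * int n) = inv (h [^] n) \<otimes> g [^] n"
        using hc a by (simp add: inv_solve_left)
      moreover have "h [^] n \<in> H" "g [^] n \<in> H"
        using subgroup_int_pow_closed[OF H h(1), of "int n"] n(2) KH by (auto simp: int_pow_int)
      ultimately have *: "a [^] (i * int n) \<in> H"
        using H by (simp add: subgroup.m_closed subgroup.m_inv_closed)
      have "i = 0"
      proof (rule ccontr)
        assume "i \<noteq> 0"
        \<comment> \<open>The case assumption concerns positive natural exponents; raising to
          \<open>sgn i\<close> makes the exponent positive.\<close>
        have "(a [^] (i * int n)) [^] (sgn i) \<in> H" using * H by (simp add: subgroup_int_pow_closed)
        moreover have "i * int n * sgn i = int (nat \<bar>i\<bar> * n)"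
          by (cases "i > 0") (simp_all add: sgn_if)
        ultimately have "a [^] (int (nat \<bar>i\<bar> * n)) \<in> H"
          by (simp only: int_pow_pow[OF a])
        moreover have "nat \<bar>i\<bar> * n > 0" using n \<open>i \<noteq> 0\<close> by simp
        ultimately show False using False unfolding int_pow_int by blast
      qed
      then have "g \<in> H" using h hc by simp
      then show ?thesis using M n by blast
    qed
    then show ?thesis using M(1) by (intro exI[of _ M]) auto
  qed
qed

section \<open>The self-similar sequence\<close>

text \<open>This is the pattern \<open>10??0\<close>: two symbols of \<open>z\<close> occupy a block
  of length 5. Its only fixed point is the Toeplitz word \<open>hole_seq\<close> of this
  pattern.\<close>

definition fill :: "(int \<Rightarrow> nat) \<Rightarrow> int \<Rightarrow> nat"
  where "fill z n =
    (if n mod 5 = 0 then 1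
     else if n mod 5 = 2 then z (2 * (n div 5))
     else if n mod 5 = 3 then z (2 * (n div 5) + 1)
     else 0)"

text \<open>Blocks are taken to start at multiples of \<open>5\<close>; points of another phase are
  shifted first.\<close>

definition unfill :: "(int \<Rightarrow> nat) \<Rightarrow> int \<Rightarrow> nat"
  where "unfill y n = y (if even n then 5 * (n div 2) + 2 else 5 * (n div 2) + 3)"

lemma fill_simps [simp]:
  "fill z (5 * m) = 1" "fill z (5 * m + 1) = 0" "fill z (5 * m + 2) = z (2 * m)"
  "fill z (5 * m + 3) = z (2 * m + 1)" "fill z (5 * m + 4) = 0"
  by (simp_all add: fill_def)

lemma unfill_fill [simp]: "unfill (fill z) = z"
  by (auto simp: unfill_def fun_eq_iff)

lemma unfill_shift: "unfill (shift_pow (5 * k) y) = shift_pow (2 * k) (unfill y)"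
  by (auto simp: unfill_def fun_eq_iff algebra_simps)

lemma fill_shift: "fill (shift_pow (2 * k) z) = shift_pow (5 * k) (fill z)"
  by (auto simp: fill_def fun_eq_iff algebra_simps)

lemma mod5_cases:
  fixes n :: int
  obtains m where "n = 5 * m" | m where "n = 5 * m + 1" | m where "n = 5 * m + 2"
    | m where "n = 5 * m + 3" | m where "n = 5 * m + 4"
proof -
  have "n = 5 * (n div 5) + n mod 5" by simp
  moreover have "n mod 5 \<in> {0, 1, 2, 3, 4}"
    by simp presburger
  ultimately show ?thesis using that by fastforce
qed

text \<open>The number of a hole is at most its position in absolute value, so the window does not
  shrink.\<close>

lemma agree_fill: "agree N y z \<Longrightarrow> agree N (fill y) (fill z)"
proof (unfold agree_def, intro allI impI)
  fix i assume y: "\<forall>i. \<bar>i\<bar> \<le> N \<longrightarrow> y i = z i" and i: "\<bar>i\<bar> \<le> N"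
  show "fill y i = fill z i"
  proof (cases i rule: mod5_cases)
    case (3 m)
    have "\<bar>2 * m\<bar> \<le> N" using i 3 by linarith
    then show ?thesis using y 3 by simp
  next
    case (4 m)
    have "\<bar>2 * m + 1\<bar> \<le> N" using i 4 by (cases "m \<ge> 0") auto
    then show ?thesis using y 4 by simp
  qed simp_all
qed

text \<open>Hole \<open>n\<close> lies at distance at most \<open>5/2 * \<bar>n\<bar> + 2\<close>
  from the origin; \<open>3 * N + 5\<close> is a convenient integral bound.\<close>

lemma agree_unfill: "agree (3 * N + 5) y z \<Longrightarrow> agree N (unfill y) (unfill z)"
  unfolding agree_def unfill_def by auto

function hole_seq :: "int \<Rightarrow> nat"
  where "hole_seq n =
    (if n mod 5 = 0 then 1
     else if n mod 5 = 2 then hole_seq (2 * (n div 5))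
     else if n mod 5 = 3 then hole_seq (2 * (n div 5) + 1)
     else 0)"
  by auto
termination
proof (relation "Wellfounded.measure (\<lambda>n. nat \<bar>n\<bar>)")
  fix n :: int
  have n: "n = 5 * (n div 5) + n mod 5" by simp
  show "(2 * (n div 5), n) \<in> Wellfounded.measure (\<lambda>n. nat \<bar>n\<bar>)" if "n mod 5 = 2"
    using n that by (cases "n div 5 \<ge> 0") auto
  show "(2 * (n div 5) + 1, n) \<in> Wellfounded.measure (\<lambda>n. nat \<bar>n\<bar>)" if "n mod 5 = 3"
    using n that by (cases "n div 5 \<ge> 0") auto
qed simp

declare hole_seq.simps [simp del]

lemma fill_hole_seq: "fill hole_seq = hole_seq"
  by (rule ext) (simp add: fill_def hole_seq.simps)

lemma unfill_hole_seq: "unfill hole_seq = hole_seq"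
  by (metis unfill_fill fill_hole_seq)

lemma hole_seq_simps [simp]:
  "hole_seq (5 * m) = 1" "hole_seq (5 * m + 1) = 0" "hole_seq (5 * m + 2) = hole_seq (2 * m)"
  "hole_seq (5 * m + 3) = hole_seq (2 * m + 1)" "hole_seq (5 * m + 4) = 0"
  using fill_simps[of hole_seq m] unfolding fill_hole_seq by auto

lemma hole_seq_range: "hole_seq n \<in> {0, 1}"
  by (induction n rule: hole_seq.induct) (subst hole_seq.simps, auto)

section \<open>Periodic positions and the rigidity of their pattern\<close>

text \<open>For \<open>p = 5 ^ n\<close> this is the \<open>p\<close>-periodic part of a Toeplitz
  sequence. It contains every position filled within the first \<open>n\<close> rounds.\<close>

definition per_at :: "nat \<Rightarrow> int \<Rightarrow> bool"
  where "per_at n i \<longleftrightarrow> (\<forall>m. hole_seq (i + m * 5 ^ n) = hole_seq i)"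

lemma per_at_mono:
  assumes "per_at n i" "n \<le> n'"
  shows "per_at n' i"
proof -
  have "(5::int) ^ n' = 5 ^ (n' - n) * 5 ^ n"
    using assms(2) by (simp flip: power_add)
  then show ?thesis
    using assms(1) unfolding per_at_def by (metis mult.assoc)
qed

text \<open>A translation by \<open>5 ^ Suc n\<close> moves hole numbers by
  \<open>2 * 5 ^ n\<close>, a multiple of the period one level below.\<close>

lemma per_at_Suc:
  "per_at (Suc n) (5 * m)" "per_at (Suc n) (5 * m + 1)" "per_at (Suc n) (5 * m + 4)"
  "per_at n (2 * m) \<Longrightarrow> per_at (Suc n) (5 * m + 2)"
  "per_at n (2 * m + 1) \<Longrightarrow> per_at (Suc n) (5 * m + 3)"
proof -
  have eq: "5 * m + r + k * 5 ^ Suc n = 5 * (m + k * 5 ^ n) + r" for k r :: int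
    by (simp add: algebra_simps)
  show "per_at (Suc n) (5 * m)" "per_at (Suc n) (5 * m + 1)" "per_at (Suc n) (5 * m + 4)"
    unfolding per_at_def eq eq[of 0, unfolded add_0_right] hole_seq_simps by blast+
  have eq2: "2 * (m + k * 5 ^ n) = 2 * m + (2 * k) * 5 ^ n"
    "2 * (m + k * 5 ^ n) + 1 = (2 * m + 1) + (2 * k) * 5 ^ n" for k :: int
    by (simp_all add: algebra_simps)
  show "per_at n (2 * m) \<Longrightarrow> per_at (Suc n) (5 * m + 2)"
    unfolding per_at_def eq hole_seq_simps eq2 by blast
  show "per_at n (2 * m + 1) \<Longrightarrow> per_at (Suc n) (5 * m + 3)"
    unfolding per_at_def eq hole_seq_simps eq2(2) by blast
qed

lemma ex_per_at: "\<exists>n. per_at n i"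
proof (induction "nat \<bar>i\<bar>" arbitrary: i rule: less_induct)
  case less
  show ?case
  proof (cases i rule: mod5_cases)
    case (3 m)
    have "nat \<bar>2 * m\<bar> < nat \<bar>i\<bar>" using 3 by (cases "m \<ge> 0") auto
    then show ?thesis using less per_at_Suc(4) 3 by blast
  next
    case (4 m)
    have "nat \<bar>2 * m + 1\<bar> < nat \<bar>i\<bar>" using 4 by (cases "m \<ge> 0") auto
    then show ?thesis using less per_at_Suc(5) 4 by blast
  qed (use per_at_Suc in blast)+
qed

lemma ex_per_at_window: "\<exists>n. \<forall>i\<in>{a..b}. per_at n i"
proof -
  obtain f where f: "\<And>i. per_at (f i) i" using ex_per_at by metis
  have "f i \<le> Max (f ` {a..b})" if "i \<in> {a..b}" for i
    using that by (intro Max_ge) auto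
  then show ?thesis using f per_at_mono by blast
qed

text \<open>Since \<open>2\<close> is invertible modulo \<open>5\<close>, the numbers of five
  consecutive holes of one class meet every residue, and a hole whose number has residue
  \<open>1\<close> carries a \<open>0\<close>. So neither class of holes can imitate the ones at the
  multiples of \<open>5\<close>.\<close>

lemma hole_seq_zero_in_progression:
  fixes j r :: int
  assumes "r \<in> {2, 3}"
  obtains m where "m \<in> {0..4}" "hole_seq (5 * (j + m) + r) = 0"
proof -
  \<comment> \<open>This solves \<open>2 * (j + m) mod 5 = 1\<close> for \<open>r = 2\<close> and
    \<open>(2 * (j + m) + 1) mod 5 = 1\<close> for \<open>r = 3\<close>.\<close>
  define m where "m = (if r = 2 then (3 - j) mod 5 else (- j) mod 5)"
  have m: "m \<in> {0..4}"
  proof -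
    have "x mod 5 \<in> {0..4}" for x :: int
      using pos_mod_bound[of 5 x] pos_mod_sign[of 5 x] unfolding atLeastAtMost_iff by linarith
    then show ?thesis unfolding m_def by presburger
  qed
  have "hole_seq (5 * (j + m) + r) = 0"
  proof (cases "r = 2")
    case True
    then have "(j + m) mod 5 = 3"
      by (simp add: m_def mod_simps)
    then obtain q where "j + m = 5 * q + 3"
      by (metis mult_div_mod_eq)
    then have "2 * (j + m) = 5 * (2 * q + 1) + 1" by simp
    then show ?thesis
      using True hole_seq_simps(2,3) by metis
  next
    case False
    then have "(j + m) mod 5 = 0"
      by (simp add: m_def mod_simps)
    then obtain q where "j + m = 5 * q"
      by (metis dvdE mod_0_imp_dvd)
    then have "2 * (j + m) + 1 = 5 * (2 * q) + 1" "r = 3" using False assms by simp_all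
    then show ?thesis
      using hole_seq_simps(2,4) by metis
  qed
  then show ?thesis
    using that m by blast
qed

text \<open>Residues \<open>1\<close> and \<open>4\<close> carry only zeros, and the previous lemma
  excludes the hole residues. Five symbols thus suffice to recognise where the blocks begin.\<close>

lemma hole_seq_one_progression:
  assumes "\<And>m. m \<in> {0..4} \<Longrightarrow> hole_seq (k + 5 * m) = 1"
  shows "5 dvd k"
proof (cases k rule: mod5_cases)
  case (3 j)
  then show ?thesis
    using hole_seq_zero_in_progression[of 2 j] assms
    by (metis add.commute add.left_commute distrib_left insertI1 zero_neq_one)
next
  case (4 j)
  then show ?thesis
    using hole_seq_zero_in_progression[of 3 j] assms
    by (metis add.commute add.left_commute distrib_left insertCI zero_neq_one)
qed (use assms[of 0] in auto)

text \<open>The ones at multiples of \<open>5\<close> force \<open>k = 5 * e\<close>. The holes are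
  then translated by \<open>2 * e\<close>, so the induction hypothesis applies to them, and the
  factor \<open>2\<close> is coprime to \<open>5 ^ n\<close>. The window depends on \<open>n\<close>
  but not on \<open>k\<close>.\<close>

lemma skeleton_rigid:
  "\<exists>N. \<forall>k. (\<forall>i. \<bar>i\<bar> \<le> N \<longrightarrow> per_at n i \<longrightarrow> hole_seq (i + k) = hole_seq i) \<longrightarrow> 5 ^ n dvd k"
proof (induction n)
  case 0
  show ?case by simp
next
  case (Suc n)
  then obtain N where N: "\<And>k. (\<And>i. \<bar>i\<bar> \<le> N \<Longrightarrow> per_at n i \<Longrightarrow> hole_seq (i + k) = hole_seq i)
      \<Longrightarrow> 5 ^ n dvd k" by blast
  show ?case
  \<comment> \<open>This window contains the test positions \<open>0, 5, ..., 20\<close> and every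
    hole whose number is at most \<open>\<bar>N\<bar>\<close> in absolute value.\<close>
  proof (intro exI[of _ "5 * \<bar>N\<bar> + 25"] allI impI)
    fix k assume k: "\<forall>i. \<bar>i\<bar> \<le> 5 * \<bar>N\<bar> + 25 \<longrightarrow> per_at (Suc n) i \<longrightarrow> hole_seq (i + k) = hole_seq i"
    have "hole_seq (k + 5 * m) = 1" if "m \<in> {0..4}" for m
    proof -
      have "\<bar>5 * m\<bar> \<le> 5 * \<bar>N\<bar> + 25" using that by auto
      then have "hole_seq (5 * m + k) = hole_seq (5 * m)" using k per_at_Suc(1) by blast
      then show ?thesis by (simp add: add.commute)
    qed
    then obtain e where e: "k = 5 * e"
      using hole_seq_one_progression by (meson dvdE)
    have "5 ^ n dvd 2 * e"
    proof (rule N)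
      fix j assume j: "\<bar>j\<bar> \<le> N" "per_at n j"
      define m where "m = j div 2"
      consider "j = 2 * m" | "j = 2 * m + 1" unfolding m_def
        by (metis even_two_times_div_two odd_two_times_div_two_succ)
      then show "hole_seq (j + 2 * e) = hole_seq j"
      proof cases
        case 1
        have "\<bar>5 * m + 2\<bar> \<le> 5 * \<bar>N\<bar> + 25" using j 1 by simp
        with k per_at_Suc(4) j 1 have "hole_seq (5 * m + 2 + k) = hole_seq (5 * m + 2)" by blast
        moreover have "5 * m + 2 + k = 5 * (m + e) + 2" by (simp add: e)
        ultimately show ?thesis by (metis 1 hole_seq_simps(3) distrib_left)
      next
        case 2
        have "\<bar>5 * m + 3\<bar> \<le> 5 * \<bar>N\<bar> + 25" using j 2 by simp
        with k per_at_Suc(5) j 2 have "hole_seq (5 * m + 3 + k) = hole_seq (5 * m + 3)" by blast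
        moreover have "5 * m + 3 + k = 5 * (m + e) + 3" by (simp add: e)
        moreover have "2 * (m + e) + 1 = j + 2 * e" using 2 by simp
        ultimately show ?thesis by (metis 2 hole_seq_simps(4))
      qed
    qed
    moreover have "coprime ((5::int) ^ n) 2" by simp
    ultimately show "5 ^ Suc n dvd k"
      by (simp add: coprime_dvd_mult_right_iff e)
  qed
qed

text \<open>By rigidity a period is divisible by every power of \<open>5\<close>.\<close>

lemma hole_seq_aperiodic:
  assumes "\<And>i. hole_seq (i + d) = hole_seq i"
  shows "d = 0"
proof (rule ccontr)
  assume "d \<noteq> 0"
  obtain n where "\<bar>d\<bar> < 5 ^ n"
    using real_arch_pow[of 5 "real_of_int \<bar>d\<bar>"]
    by (metis numeral_One of_int_less_iff of_int_numeral of_int_power one_less_numeral_iff semiring_norm(77))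
  moreover have "5 ^ n dvd d"
    using skeleton_rigid[of n] assms by blast
  ultimately show False
    using \<open>d \<noteq> 0\<close> dvd_imp_le_int[of d "5 ^ n"] by simp
qed

section \<open>The orbit closure\<close>

definition hole_shift :: "(int \<Rightarrow> nat) set"
  where "hole_shift = (full_shift {0, 1}) closure_of {shift_pow i hole_seq | i. True}"

lemma shift_pow_hole_seq_in: "shift_pow k hole_seq \<in> topspace (full_shift {0, 1})"
  using hole_seq_range by (simp add: topspace_full_shift)

lemma hole_shift_iff: "y \<in> hole_shift \<longleftrightarrow> (\<forall>N. \<exists>k. agree N y (shift_pow k hole_seq))"
proof -
  have "{shift_pow i hole_seq | i. True} \<subseteq> topspace (full_shift {0, 1})"
    using shift_pow_hole_seq_in by auto
  note iff = in_closure_full_shift[OF this, of y]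
  have "y i \<in> {0, 1}" if y: "\<forall>N. \<exists>k. agree N y (shift_pow k hole_seq)" for i
  proof -
    obtain k where "agree \<bar>i\<bar> y (shift_pow k hole_seq)" using y by blast
    then have "y i = hole_seq (i + k)" by (simp add: agree_def)
    then show ?thesis using hole_seq_range by simp
  qed
  then show ?thesis
    unfolding hole_shift_def iff topspace_full_shift by blast
qed

lemma hole_shiftE:
  assumes "y \<in> hole_shift"
  obtains k where "agree N y (shift_pow k hole_seq)"
  using assms by (auto simp: hole_shift_iff)

lemma hole_shift_topspace: "hole_shift \<subseteq> topspace (full_shift {0, 1})"
  unfolding hole_shift_def by (rule closure_of_subset_topspace)

lemma hole_seq_in [simp]: "hole_seq \<in> hole_shift"
proof -
  have "agree N hole_seq (shift_pow 0 hole_seq)" for N by (simp add: agree_def)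
  then show ?thesis unfolding hole_shift_iff by blast
qed

lemma shift_pow_in [simp]:
  assumes "y \<in> hole_shift"
  shows "shift_pow k y \<in> hole_shift"
  unfolding hole_shift_iff
proof
  fix N
  obtain l where "agree (N + \<bar>k\<bar>) y (shift_pow l hole_seq)" using hole_shiftE[OF assms] .
  from agree_shift_pow[OF this] show "\<exists>l. agree N (shift_pow k y) (shift_pow l hole_seq)"
    by auto
qed

lemma shift_image_shift_pow_invariant:
  assumes "\<And>k y. y \<in> X \<Longrightarrow> shift_pow k y \<in> X"
  shows "shift ` X = X"
proof
  show "shift ` X \<subseteq> X" using assms[of _ 1] by (auto simp: shift_pow_1)
  show "X \<subseteq> shift ` X"
  proof
    fix y assume "y \<in> X"
    then have "shift_pow (-1) y \<in> X" "shift (shift_pow (-1) y) = y"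
      using assms by (simp_all flip: shift_pow_1)
    then show "y \<in> shift ` X" by (metis imageI)
  qed
qed

lemma shift_pow_in_shift_invariant:
  assumes "shift ` Y = Y" "y \<in> Y"
  shows "shift_pow k y \<in> Y"
proof (induction k rule: int_induct[where k = 0])
  case base
  show ?case using assms by simp
next
  case (step1 i)
  have "shift_pow (i + 1) y = shift (shift_pow i y)"
    by (simp add: add.commute flip: shift_pow_1)
  then show ?case using step1 assms by (metis imageI)
next
  case (step2 i)
  obtain z where z: "z \<in> Y" "shift z = shift_pow i y" using step2 assms by (metis imageE)
  have "shift_pow (i - 1) y = shift_pow (-1) (shift_pow i y)" by simp
  also have "\<dots> = z" by (simp flip: z(2) shift_pow_1)
  finally show ?case using z by simp
qed

section \<open>Recurrence, the Toeplitz property and minimality\<close>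

text \<open>A window is finite, so all its positions are periodic at one common level.\<close>

lemma hole_seq_recurrent: "\<exists>n. \<forall>m. agree N (shift_pow (k + m * 5 ^ n) hole_seq) (shift_pow k hole_seq)"
proof -
  obtain n where n: "\<forall>i\<in>{k - N..k + N}. per_at n i" using ex_per_at_window by blast
  have "hole_seq (i + (k + m * 5 ^ n)) = hole_seq (i + k)" if "\<bar>i\<bar> \<le> N" for i m
  proof -
    have "i + k \<in> {k - N..k + N}" using that by auto
    then have "per_at n (i + k)" using n by blast
    then show ?thesis unfolding per_at_def by (simp add: add.assoc)
  qed
  then show ?thesis by (auto simp: agree_def)
qed

lemma subshift_hole_shift: "subshift {0, 1} hole_shift"
  unfolding subshift_def
  using shift_image_shift_pow_invariant[of hole_shift] closedin_closure_of[of "full_shift {0, 1}"]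
  by (metis shift_pow_in hole_shift_def)

lemma toeplitz_hole_shift: "toeplitz_subshift {0, 1} hole_shift"
proof -
  have "\<exists>p>0. \<forall>k. hole_seq (i + k * p) = hole_seq i" for i
    using ex_per_at[of i] unfolding per_at_def by (metis zero_less_numeral zero_less_power)
  moreover have "hole_seq \<in> topspace (full_shift {0, 1})"
    using shift_pow_hole_seq_in[of 0] by simp
  ultimately show ?thesis
    unfolding toeplitz_subshift_def toeplitz_point_def hole_shift_def by blast
qed

text \<open>On a long window \<open>y\<close> looks like a translate of \<open>hole_seq\<close>, and
  fewer than \<open>5 ^ n\<close> further shifts align it with a return of the central window.
  Closedness of \<open>Y\<close> gives the limit.\<close>

lemma hole_seq_in_subshift:
  assumes Y: "subshift {0, 1} Y" "Y \<subseteq> hole_shift" "y \<in> Y"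
  shows "hole_seq \<in> Y"
proof -
  have cl: "Y = (full_shift {0, 1}) closure_of Y" and top: "Y \<subseteq> topspace (full_shift {0, 1})"
    using Y unfolding subshift_def by (simp_all add: closure_of_closedin closedin_subset)
  have "\<exists>z\<in>Y. agree N hole_seq z" for N
  proof -
    obtain n where "\<forall>m. agree N (shift_pow (0 + m * 5 ^ n) hole_seq) (shift_pow 0 hole_seq)"
      using hole_seq_recurrent by blast
    then have n: "\<And>m. agree N (shift_pow (m * 5 ^ n) hole_seq) hole_seq" by simp
    obtain k where k: "agree (N + 5 ^ n) y (shift_pow k hole_seq)"
      using hole_shiftE Y by blast
    \<comment> \<open>The least non-negative shift that completes \<open>k\<close> to a multiple of
      \<open>5 ^ n\<close>. As \<open>s < 5 ^ n\<close>, the window \<open>N + 5 ^ n\<close> still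
      covers \<open>N\<close> afterwards.\<close>
    define s where "s = (- k) mod 5 ^ n"
    have "agree (N + \<bar>s\<bar>) y (shift_pow k hole_seq)"
      using k by (rule agree_mono) (simp add: s_def less_imp_le)
    then have "agree N (shift_pow s y) (shift_pow (s + k) hole_seq)"
      using agree_shift_pow by fastforce
    moreover have "5 ^ n dvd s + k"
      unfolding s_def by (simp add: dvd_eq_mod_eq_0 mod_simps)
    then obtain m where "s + k = m * 5 ^ n" by (metis dvdE mult.commute)
    ultimately have "agree N hole_seq (shift_pow s y)"
      using n[of m] by (simp add: agree_def)
    then show ?thesis
      using shift_pow_in_shift_invariant Y unfolding subshift_def by blast
  qed
  then have "hole_seq \<in> (full_shift {0, 1}) closure_of Y"
    unfolding in_closure_full_shift[OF top] using shift_pow_hole_seq_in[of 0] by simp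
  then show ?thesis using cl by simp
qed

lemma minimal_hole_shift: "minimal_subshift {0, 1} hole_shift"
proof -
  have "hole_shift \<subseteq> Y" if Y: "subshift {0, 1} Y" "Y \<noteq> {}" "Y \<subset> hole_shift" for Y
  proof -
    have "hole_seq \<in> Y" using hole_seq_in_subshift Y by blast
    then have "{shift_pow i hole_seq | i. True} \<subseteq> Y"
      using shift_pow_in_shift_invariant Y unfolding subshift_def by blast
    then show ?thesis
      unfolding hole_shift_def using Y by (simp add: closure_of_minimal subshift_def)
  qed
  then show ?thesis
    unfolding minimal_subshift_def using subshift_hole_shift by blast
qed

section \<open>Phases modulo 5\<close>

definition phase :: "(int \<Rightarrow> nat) \<Rightarrow> int \<Rightarrow> bool"
  where "phase y c \<longleftrightarrow> (\<forall>m. y (5 * m + c) = 1)"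

lemma phase_shift_pow: "phase (shift_pow k y) c \<longleftrightarrow> phase y (c + k)"
  by (simp add: phase_def add.assoc)

lemma phase_fill [simp]: "phase (fill z) 0"
  by (simp add: phase_def)

lemma phase_cong:
  assumes "phase y c" "5 dvd c - c'"
  shows "phase y c'"
proof -
  obtain e where e: "c - c' = 5 * e" using assms(2) by blast
  show ?thesis unfolding phase_def
  proof
    fix m
    have "5 * m + c' = 5 * (m - e) + c" using e by simp
    then show "y (5 * m + c') = 1" using assms(1) unfolding phase_def by metis
  qed
qed

text \<open>The window reaches the five positions \<open>5 * m + c\<close> with
  \<open>m \<in> {0..4}\<close>, where block starts are recognised.\<close>

lemma phase_agree:
  assumes "phase y c" "agree (\<bar>c\<bar> + 20) y (shift_pow k hole_seq)"
  shows "5 dvd c + k"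
proof (rule hole_seq_one_progression)
  fix m :: int assume m: "m \<in> {0..4}"
  then have "\<bar>5 * m + c\<bar> \<le> \<bar>c\<bar> + 20" by auto
  then have "y (5 * m + c) = hole_seq (5 * m + c + k)" using assms(2) by (simp add: agree_def)
  then show "hole_seq (c + k + 5 * m) = 1"
    using assms(1) by (simp add: phase_def add_ac)
qed

lemma ex_phase:
  assumes "y \<in> hole_shift"
  shows "\<exists>c. phase y c"
proof -
  obtain k0 where k0: "agree 30 y (shift_pow k0 hole_seq)" using hole_shiftE[OF assms] .
  define c where "c = (- k0) mod 5"
  have c: "0 \<le> c" "c < 5" "5 dvd c + k0"
    unfolding c_def by (simp_all add: dvd_eq_mod_eq_0 mod_simps)
  \<comment> \<open>Every translate close to \<open>y\<close> on this fixed window has the phase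
    read off from \<open>k0\<close>, so larger windows cannot change it. The test positions are at
    most \<open>5 * 4 + 4\<close>, hence inside \<open>30\<close>.\<close>
  have phase: "5 dvd c + k" if k: "agree 30 y (shift_pow k hole_seq)" for k
  proof (rule hole_seq_one_progression)
    fix m :: int assume m: "m \<in> {0..4}"
    then have i: "\<bar>5 * m + c\<bar> \<le> 30" using c by auto
    have "hole_seq (5 * m + c + k) = hole_seq (5 * m + c + k0)"
      using agreeD[OF k i] agreeD[OF k0 i] by simp
    moreover obtain e where "c + k0 = 5 * e" using c by blast
    then have "5 * m + c + k0 = 5 * (m + e)" by simp
    ultimately have "hole_seq (5 * m + c + k) = 1"
      using hole_seq_simps(1) by metis
    then show "hole_seq (c + k + 5 * m) = 1" by (simp add: add_ac)
  qed
  have "y (5 * m + c) = 1" for m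
  proof -
    obtain k where k: "agree (max 30 \<bar>5 * m + c\<bar>) y (shift_pow k hole_seq)"
      using hole_shiftE[OF assms] .
    then have "5 dvd c + k" by (intro phase agree_mono[OF k]) simp
    then obtain e where "c + k = 5 * e" by blast
    then have e: "5 * m + c + k = 5 * (m + e)" by simp
    have "y (5 * m + c) = hole_seq (5 * m + c + k)" using agreeD[OF k, of "5 * m + c"] by simp
    then show ?thesis unfolding e hole_seq_simps(1) .
  qed
  then show ?thesis unfolding phase_def by blast
qed

text \<open>Orbit translates close to the aligned point are shifts by multiples of \<open>5\<close>,
  where both claims follow from \<open>fill hole_seq = hole_seq\<close>. Both are tested on finite
  windows and so pass to the limit.\<close>

lemma fill_unfill_phase:
  assumes y: "y \<in> hole_shift" and c: "phase y c"
  shows "fill (unfill (shift_pow c y)) = shift_pow c y" "unfill (shift_pow c y) \<in> hole_shift"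
proof -
  have *: "\<exists>k. agree N (unfill (shift_pow c y)) (shift_pow k hole_seq) \<and>
      agree N (fill (unfill (shift_pow c y))) (shift_pow c y)" for N
  proof -
    \<comment> \<open>Room for the shift by \<open>c\<close>, for \<open>phase_agree\<close>, and
      for \<open>agree_unfill\<close>.\<close>
    define M where "M = 3 * \<bar>N\<bar> + 25 + \<bar>c\<bar>"
    obtain k where k: "agree M y (shift_pow k hole_seq)" using hole_shiftE[OF y] .
    have "5 dvd c + k" by (intro phase_agree[OF c] agree_mono[OF k]) (simp add: M_def)
    then obtain e where e: "c + k = 5 * e" by blast
    have "agree (3 * \<bar>N\<bar> + 25) (shift_pow c y) (shift_pow (c + k) hole_seq)"
      using agree_shift_pow[OF k[unfolded M_def]] by simp
    then have 1: "agree (3 * \<bar>N\<bar> + 25) (shift_pow c y) (shift_pow (5 * e) hole_seq)"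
      by (simp add: e)
    have "agree N (unfill (shift_pow c y)) (unfill (shift_pow (5 * e) hole_seq))"
      by (intro agree_unfill agree_mono[OF 1]) simp
    then have 2: "agree N (unfill (shift_pow c y)) (shift_pow (2 * e) hole_seq)"
      by (simp add: unfill_shift unfill_hole_seq)
    have "agree N (fill (unfill (shift_pow c y))) (shift_pow (5 * e) hole_seq)"
      using agree_fill[OF 2] by (simp add: fill_shift fill_hole_seq)
    then show ?thesis using 1 2 by (auto simp: agree_def)
  qed
  then show "unfill (shift_pow c y) \<in> hole_shift" unfolding hole_shift_iff by blast
  show "fill (unfill (shift_pow c y)) = shift_pow c y"
  proof
    fix i show "fill (unfill (shift_pow c y)) i = shift_pow c y i"
      using *[of "\<bar>i\<bar>"] by (auto simp: agree_def)
  qed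
qed

lemma fill_in [simp]:
  assumes z: "z \<in> hole_shift"
  shows "fill z \<in> hole_shift"
  unfolding hole_shift_iff
proof
  fix N
  obtain k where k: "agree N z (shift_pow k hole_seq)" using hole_shiftE[OF z] .
  obtain n where n: "\<forall>m. agree N (shift_pow (k + m * 5 ^ n) hole_seq) (shift_pow k hole_seq)"
    using hole_seq_recurrent by blast
  \<comment> \<open>\<open>fill_shift\<close> treats even shifts only. Recurrence allows
    \<open>k\<close> to be replaced by \<open>k + k * 5 ^ n\<close>, which is even because
    \<open>5 ^ n\<close> is odd.\<close>
  have "even (k + k * 5 ^ n)" by simp
  then obtain e where e: "k + k * 5 ^ n = 2 * e" by blast
  then have "agree N z (shift_pow (2 * e) hole_seq)"
    using k n[rule_format, of k] by (simp add: agree_def)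
  from agree_fill[OF this] have "agree N (fill z) (shift_pow (5 * e) hole_seq)"
    by (simp add: fill_shift fill_hole_seq)
  then show "\<exists>k. agree N (fill z) (shift_pow k hole_seq)" by blast
qed

lemma hole_shift_cases:
  assumes "y \<in> hole_shift"
  obtains c z where "z \<in> hole_shift" "y = shift_pow c (fill z)"
proof -
  obtain c where c: "phase y c" using ex_phase[OF assms] by blast
  have "y = shift_pow (- c) (shift_pow c y)" by simp
  then show ?thesis
    using fill_unfill_phase[OF assms c] that by metis
qed

lemma phase_diff:
  assumes "y \<in> hole_shift" "phase y c" "phase y c'"
  shows "5 dvd c - c'"
proof -
  obtain k where k: "agree (\<bar>c\<bar> + \<bar>c'\<bar> + 20) y (shift_pow k hole_seq)" using hole_shiftE[OF assms(1)] .
  have "5 dvd c + k" by (intro phase_agree[OF assms(2)] agree_mono[OF k]) simp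
  moreover have "5 dvd c' + k" by (intro phase_agree[OF assms(3)] agree_mono[OF k]) simp
  ultimately show ?thesis by presburger
qed

section \<open>Lifting automorphisms to the holes\<close>

definition equivariant :: "((int \<Rightarrow> nat) \<Rightarrow> int \<Rightarrow> nat) \<Rightarrow> bool"
  where "equivariant f \<longleftrightarrow> f \<in> hole_shift \<rightarrow> hole_shift \<and>
    (\<forall>y\<in>hole_shift. \<forall>k. f (shift_pow k y) = shift_pow k (f y))"

lemma equivariant_in: "equivariant f \<Longrightarrow> y \<in> hole_shift \<Longrightarrow> f y \<in> hole_shift"
  by (auto simp: equivariant_def)

lemma equivariant_shift_pow:
  "equivariant f \<Longrightarrow> y \<in> hole_shift \<Longrightarrow> f (shift_pow k y) = shift_pow k (f y)"
  by (simp add: equivariant_def)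

text \<open>For equivariant \<open>f\<close> the chosen phase is immaterial, by
  \<open>lift_fill\<close>. The restriction makes the result extensional, as elements of the
  automorphism group are.\<close>

definition lift :: "((int \<Rightarrow> nat) \<Rightarrow> int \<Rightarrow> nat) \<Rightarrow> (int \<Rightarrow> nat) \<Rightarrow> int \<Rightarrow> nat"
  where "lift f = (\<lambda>y\<in>hole_shift.
    let c = SOME c. phase y c in shift_pow (- c) (fill (f (unfill (shift_pow c y)))))"

text \<open>The chosen phase differs from \<open>- c\<close> by some \<open>5 * e\<close>. This
  moves the holes by \<open>2 * e\<close>, and equivariance carries that shift through
  \<open>f\<close>.\<close>

lemma lift_fill:
  assumes f: "equivariant f" and z: "z \<in> hole_shift"
  shows "lift f (shift_pow c (fill z)) = shift_pow c (fill (f z))"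
proof -
  define y where "y = shift_pow c (fill z)"
  have y: "y \<in> hole_shift" "phase y (- c)" using z by (simp_all add: y_def phase_shift_pow)
  define d where "d = (SOME d. phase y d)"
  have d: "phase y d" unfolding d_def using y(2) by (rule someI)
  then obtain e where "d - (- c) = 5 * e" using phase_diff[OF y(1) d y(2)] by blast
  then have dc: "d + c = 5 * e" by simp
  have "unfill (shift_pow d y) = shift_pow (2 * e) z"
    by (simp add: y_def dc unfill_shift)
  then have "lift f y = shift_pow (- d) (fill (shift_pow (2 * e) (f z)))"
    using y(1) equivariant_shift_pow[OF f z] by (simp only: lift_def restrict_apply if_True Let_def flip: d_def)
  also have "\<dots> = shift_pow (- d) (shift_pow (5 * e) (fill (f z)))" by (simp add: fill_shift)
  also have "\<dots> = shift_pow c (fill (f z))" by (simp flip: dc)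
  finally show ?thesis by (simp add: y_def)
qed

lemma equivariant_lift:
  assumes f: "equivariant f"
  shows "equivariant (lift f)"
proof -
  have "lift f y \<in> hole_shift \<and> lift f (shift_pow k y) = shift_pow k (lift f y)"
    if y: "y \<in> hole_shift" for y k
  proof -
    obtain c z where "z \<in> hole_shift" "y = shift_pow c (fill z)" using hole_shift_cases[OF y] .
    then show ?thesis using lift_fill[OF f] equivariant_in[OF f] by simp
  qed
  then show ?thesis unfolding equivariant_def by blast
qed

lemma lift_comp:
  assumes "equivariant f" "equivariant g" "equivariant h"
    and "\<And>z. z \<in> hole_shift \<Longrightarrow> h z = f (g z)" and y: "y \<in> hole_shift"
  shows "lift h y = lift f (lift g y)"
proof -
  obtain c z where "z \<in> hole_shift" "y = shift_pow c (fill z)" using hole_shift_cases[OF y] .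
  then show ?thesis using assms by (simp add: lift_fill equivariant_in)
qed

lemma lift_restrict_shift_pow:
  "lift (restrict (shift_pow (2 * k)) hole_shift) = restrict (shift_pow (5 * k)) hole_shift"
proof
  fix y
  show "lift (restrict (shift_pow (2 * k)) hole_shift) y = restrict (shift_pow (5 * k)) hole_shift y"
  proof (cases "y \<in> hole_shift")
    case True
    obtain c z where z: "z \<in> hole_shift" "y = shift_pow c (fill z)" using hole_shift_cases[OF True] .
    have "equivariant (restrict (shift_pow (2 * k)) hole_shift)"
      by (simp add: equivariant_def add.commute)
    then show ?thesis
      using z by (simp add: lift_fill fill_shift add.commute)
  qed (simp add: lift_def)
qed

section \<open>Continuity of lifted maps\<close>

definition window_continuous :: "((int \<Rightarrow> nat) \<Rightarrow> int \<Rightarrow> nat) \<Rightarrow> bool"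
  where "window_continuous f \<longleftrightarrow>
    (\<forall>y\<in>hole_shift. \<forall>M. \<exists>N. \<forall>z\<in>hole_shift. agree N y z \<longrightarrow> agree M (f y) (f z))"

lemma window_continuousE:
  assumes "window_continuous f" "y \<in> hole_shift"
  obtains N where "\<And>z. z \<in> hole_shift \<Longrightarrow> agree N y z \<Longrightarrow> agree M (f y) (f z)"
  using assms unfolding window_continuous_def by blast

text \<open>Points close to \<open>y\<close> share its phase, so they are the same shift of filled
  points whose holes are close to those of \<open>y\<close>; continuity of \<open>f\<close> then
  applies to the holes.\<close>

lemma window_continuous_lift:
  assumes f: "equivariant f" and cont: "window_continuous f"
  shows "window_continuous (lift f)"
  unfolding window_continuous_def
proof (intro ballI allI)
  fix y M assume y: "y \<in> hole_shift"
  obtain c z where z: "z \<in> hole_shift" and yz: "y = shift_pow c (fill z)" using hole_shift_cases[OF y] .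
  obtain N where N: "\<And>w. w \<in> hole_shift \<Longrightarrow> agree N z w \<Longrightarrow> agree (M + \<bar>c\<bar>) (f z) (f w)"
    using window_continuousE[OF cont z] by blast
  define K where "K = 3 * \<bar>N\<bar> + \<bar>c\<bar> + 30"
  have "agree M (lift f y) (lift f w)" if w: "w \<in> hole_shift" and yw: "agree K y w" for w
  proof -
    obtain d where d: "phase w d" using ex_phase[OF w] by blast
    obtain k where k: "agree (K + \<bar>d\<bar>) w (shift_pow k hole_seq)" using hole_shiftE[OF w] .
    have "5 dvd d + k" by (intro phase_agree[OF d] agree_mono[OF k]) (simp add: K_def)
    \<comment> \<open>Comparing \<open>y\<close> and \<open>w\<close> with one common translate
      shows that their phases coincide modulo \<open>5\<close>, so \<open>w\<close> decomposes with
      the same \<open>c\<close> as \<open>y\<close>.\<close>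
    moreover have "agree K y (shift_pow k hole_seq)"
      using yw agree_mono[OF k, of K] by (simp add: agree_def)
    then have "5 dvd - c + k"
      by (intro phase_agree[of y]) (auto simp: yz phase_shift_pow K_def intro: agree_mono)
    ultimately have "5 dvd d - (- c)" by presburger
    then have "phase w (- c)" using phase_cong[OF d] by blast
    note u = fill_unfill_phase[OF w this]
    define v where "v = unfill (shift_pow (- c) w)"
    have v: "v \<in> hole_shift" "w = shift_pow c (fill v)" using u by (simp_all add: v_def)
    have "agree (3 * N + 5) (shift_pow (- c) y) (shift_pow (- c) w)"
      by (intro agree_shift_pow agree_mono[OF yw]) (simp add: K_def)
    from agree_unfill[OF this] have "agree N z v" by (simp add: yz v_def)
    from agree_shift_pow[OF agree_fill[OF N[OF v(1) this]]] show ?thesis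
      using lift_fill[OF f] z v yz by simp
  qed
  then show "\<exists>N. \<forall>w\<in>hole_shift. agree N y w \<longrightarrow> agree M (lift f y) (lift f w)" by blast
qed

section \<open>Automorphisms commute\<close>

text \<open>The analogue of \<open>phase\<close> modulo \<open>5 ^ n\<close>: up to sign, the class
  of \<open>c\<close> is the image of \<open>y\<close> in the level \<open>n\<close> quotient of the
  5-adic odometer.\<close>

definition skeleton :: "nat \<Rightarrow> int \<Rightarrow> (int \<Rightarrow> nat) \<Rightarrow> bool"
  where "skeleton n c y \<longleftrightarrow> (\<forall>i. per_at n i \<longrightarrow> y (i + c) = hole_seq i)"

text \<open>Every position of \<open>hole_seq\<close> is periodic at some level, so the fibre over
  the zero of the odometer is a single point.\<close>

lemma skeleton_determines:
  assumes "\<And>n. skeleton n 0 y"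
  shows "y = hole_seq"
proof
  fix i
  obtain n where "per_at n i" using ex_per_at by blast
  then show "y i = hole_seq i" using assms[of n] by (simp add: skeleton_def)
qed

text \<open>Rigidity of \<open>hole_seq\<close>, with the window enlarged by the offset, lets the
  phase modulo \<open>5 ^ n\<close> be read off a finite part of \<open>y\<close>.\<close>

lemma skeleton_agree:
  assumes "skeleton n c y"
  obtains N where "\<And>k. agree N y (shift_pow k hole_seq) \<Longrightarrow> 5 ^ n dvd c + k"
proof -
  obtain N where N: "\<And>k. (\<And>i. \<bar>i\<bar> \<le> N \<Longrightarrow> per_at n i \<Longrightarrow> hole_seq (i + k) = hole_seq i)
      \<Longrightarrow> 5 ^ n dvd k" using skeleton_rigid[of n] by blast
  have "5 ^ n dvd c + k" if k: "agree (N + \<bar>c\<bar>) y (shift_pow k hole_seq)" for k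
  proof (rule N)
    fix i assume i: "\<bar>i\<bar> \<le> N" "per_at n i"
    then have "y (i + c) = hole_seq (i + c + k)" using agreeD[OF k, of "i + c"] by simp
    then show "hole_seq (i + (c + k)) = hole_seq i"
      using assms i by (simp add: skeleton_def add.assoc)
  qed
  then show ?thesis using that by blast
qed

lemma per_at_shift: "per_at n i \<Longrightarrow> hole_seq (i + m * 5 ^ n) = hole_seq i \<and> per_at n (i + m * 5 ^ n)"
  unfolding per_at_def by (metis add.assoc distrib_right)

text \<open>If no residue class worked, finitely many coordinates of \<open>y\<close> would rule out all of them.\<close>

lemma ex_skeleton:
  assumes y: "y \<in> hole_shift"
  shows "\<exists>c. skeleton n c y"
proof (rule ccontr)
  assume "\<nexists>c. skeleton n c y"
  then obtain p where p: "\<And>c. per_at n (p c)" "\<And>c. y (p c + c) \<noteq> hole_seq (p c)"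
    unfolding skeleton_def by metis
  define N where "N = Max ((\<lambda>c. \<bar>p c + c\<bar>) ` {0..<5 ^ n})"
  obtain k where k: "agree N y (shift_pow k hole_seq)" using hole_shiftE[OF y] .
  \<comment> \<open>The class that the translate by \<open>k\<close> dictates; its counterexample
    position lies inside the window by the choice of \<open>N\<close>.\<close>
  define c where "c = (- k) mod 5 ^ n"
  have "\<bar>p c + c\<bar> \<le> N"
    unfolding N_def by (intro Max_ge imageI finite_imageI) (simp_all add: c_def)
  then have "y (p c + c) = hole_seq (p c + c + k)" using agreeD[OF k] by simp
  moreover have "5 ^ n dvd c + k"
    unfolding c_def by (simp add: dvd_eq_mod_eq_0 mod_simps)
  then obtain m where "c + k = m * 5 ^ n" by (metis dvdE mult.commute)
  then have "p c + c + k = p c + m * 5 ^ n" by simp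
  ultimately show False using p[of c] per_at_shift[OF p(1)[of c], of m] by simp
qed

text \<open>Approximate \<open>u\<close> by a translate by \<open>k\<close>; then \<open>k\<close>
  is \<open>- c\<close> modulo \<open>5 ^ n\<close>. By continuity \<open>f u\<close> is close to
  the same translate of \<open>f hole_seq\<close>, whose phase is \<open>a - k\<close>.\<close>

lemma skeleton_equivariant:
  assumes f: "equivariant f" "window_continuous f" and u: "u \<in> hole_shift"
    and a: "skeleton n a (f hole_seq)" and c: "skeleton n c u"
  shows "skeleton n (a + c) (f u)"
  unfolding skeleton_def
proof (intro allI impI)
  fix i assume i: "per_at n i"
  obtain N1 where N1: "\<And>w. w \<in> hole_shift \<Longrightarrow> agree N1 u w \<Longrightarrow> agree \<bar>i + (a + c)\<bar> (f u) (f w)"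
    using window_continuousE[OF f(2) u] by blast
  obtain N2 where N2: "\<And>k. agree N2 u (shift_pow k hole_seq) \<Longrightarrow> 5 ^ n dvd c + k"
    using skeleton_agree[OF c] by blast
  obtain k where k: "agree (max N1 N2) u (shift_pow k hole_seq)" using hole_shiftE[OF u] .
  have "5 ^ n dvd c + k" by (rule N2[OF agree_mono[OF k]]) simp
  then obtain m where m: "c + k = m * 5 ^ n" by (metis dvdE mult.commute)
  have "agree \<bar>i + (a + c)\<bar> (f u) (f (shift_pow k hole_seq))"
    by (rule N1[OF _ agree_mono[OF k]]) simp_all
  then have "f u (i + (a + c)) = f (shift_pow k hole_seq) (i + (a + c))"
    by (simp add: agree_def)
  also have "\<dots> = f hole_seq (i + (a + c) + k)"
    by (simp add: equivariant_shift_pow[OF f(1)])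
  also have "i + (a + c) + k = (i + m * 5 ^ n) + a" using m by simp
  also have "f hole_seq \<dots> = hole_seq (i + m * 5 ^ n)"
    using a per_at_shift[OF i] by (simp add: skeleton_def)
  also have "\<dots> = hole_seq i" using per_at_shift[OF i] by simp
  finally show "f u (i + (a + c)) = hole_seq i" .
qed

text \<open>The orbit of \<open>hole_seq\<close> is dense, and equivariance fixes both maps on
  it.\<close>

lemma equivariant_eqI:
  assumes f: "equivariant f" "window_continuous f" and g: "equivariant g" "window_continuous g"
    and eq: "f hole_seq = g hole_seq" and y: "y \<in> hole_shift"
  shows "f y = g y"
proof
  fix i
  obtain N1 where N1: "\<And>w. w \<in> hole_shift \<Longrightarrow> agree N1 y w \<Longrightarrow> agree \<bar>i\<bar> (f y) (f w)"
    using window_continuousE[OF f(2) y] by blast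
  obtain N2 where N2: "\<And>w. w \<in> hole_shift \<Longrightarrow> agree N2 y w \<Longrightarrow> agree \<bar>i\<bar> (g y) (g w)"
    using window_continuousE[OF g(2) y] by blast
  obtain k where k: "agree (max N1 N2) y (shift_pow k hole_seq)" using hole_shiftE[OF y] .
  have "agree \<bar>i\<bar> (f y) (f (shift_pow k hole_seq))"
    by (rule N1[OF _ agree_mono[OF k]]) simp_all
  moreover have "agree \<bar>i\<bar> (g y) (g (shift_pow k hole_seq))"
    by (rule N2[OF _ agree_mono[OF k]]) simp_all
  moreover have "f (shift_pow k hole_seq) = g (shift_pow k hole_seq)"
    using f(1) g(1) eq by (simp add: equivariant_shift_pow)
  ultimately show "f y i = g y i" by (simp add: agree_def)
qed

lemma equivariant_comp:
  assumes "equivariant f" "equivariant g"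
  shows "equivariant (\<lambda>y. f (g y))"
  using assms by (auto simp: equivariant_def Pi_iff)

lemma window_continuous_comp:
  assumes f: "window_continuous f" and g: "equivariant g" "window_continuous g"
  shows "window_continuous (\<lambda>y. f (g y))"
  unfolding window_continuous_def
proof (intro ballI allI)
  fix y M assume y: "y \<in> hole_shift"
  obtain N where N: "\<And>w. w \<in> hole_shift \<Longrightarrow> agree N (g y) w \<Longrightarrow> agree M (f (g y)) (f w)"
    using window_continuousE[OF f equivariant_in[OF g(1) y]] by blast
  obtain N' where "\<And>w. w \<in> hole_shift \<Longrightarrow> agree N' y w \<Longrightarrow> agree N (g y) (g w)"
    using window_continuousE[OF g(2) y] by blast
  then have "agree M (f (g y)) (f (g w))" if "w \<in> hole_shift" "agree N' y w" for w
    using N[OF equivariant_in[OF g(1)]] that by simp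
  then show "\<exists>N. \<forall>w\<in>hole_shift. agree N y w \<longrightarrow> agree M (f (g y)) (f (g w))" by blast
qed

text \<open>The inverse is carried along explicitly, so that an inverse of \<open>lift f\<close> is
  available as \<open>lift g\<close>.\<close>

definition dynamical_inverse :: "((int \<Rightarrow> nat) \<Rightarrow> int \<Rightarrow> nat) \<Rightarrow> ((int \<Rightarrow> nat) \<Rightarrow> int \<Rightarrow> nat) \<Rightarrow> bool"
  where "dynamical_inverse f g \<longleftrightarrow> equivariant f \<and> window_continuous f \<and> equivariant g \<and>
    window_continuous g \<and>
    (\<forall>y\<in>hole_shift. g (f y) = y \<and> f (g y) = y)"

text \<open>The phase of \<open>f y\<close> modulo \<open>5 ^ n\<close> differs from that of \<open>y\<close> by a constant depending on \<open>f\<close>.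
  So an inverse of \<open>g \<circ> f\<close> maps \<open>f (g hole_seq)\<close> to a point of phase \<open>0\<close> for every \<open>n\<close>, and
  \<open>hole_seq\<close> is the only such point.\<close>

lemma automorphisms_commute:
  assumes "dynamical_inverse f f'" "dynamical_inverse g g'" and y: "y \<in> hole_shift"
  shows "f (g y) = g (f y)"
proof -
  have f: "equivariant f" "window_continuous f" "equivariant f'" "window_continuous f'"
    "\<And>y. y \<in> hole_shift \<Longrightarrow> f' (f y) = y" "\<And>y. y \<in> hole_shift \<Longrightarrow> f (f' y) = y"
    and g: "equivariant g" "window_continuous g" "equivariant g'" "window_continuous g'"
    "\<And>y. y \<in> hole_shift \<Longrightarrow> g' (g y) = y" "\<And>y. y \<in> hole_shift \<Longrightarrow> g (g' y) = y"
    using assms(1,2) by (simp_all add: dynamical_inverse_def)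
  define h where "h = (\<lambda>y. f' (g' y))"
  have h: "equivariant h" "window_continuous h"
    unfolding h_def
    by (rule equivariant_comp[OF f(3) g(3)], rule window_continuous_comp[OF f(4) g(3,4)])
  define u v where "u = f (g hole_seq)" and "v = g (f hole_seq)"
  have uv: "u \<in> hole_shift" "v \<in> hole_shift"
    by (simp_all add: u_def v_def equivariant_in f(1) g(1))
  have hv: "h v = hole_seq"
    by (simp add: h_def v_def f(5) g(5) equivariant_in[OF f(1)])
  have "skeleton n 0 (h u)" for n
  proof -
    obtain a where a: "skeleton n a (f hole_seq)"
      using ex_skeleton[OF equivariant_in[OF f(1) hole_seq_in]] by blast
    obtain b where b: "skeleton n b (g hole_seq)"
      using ex_skeleton[OF equivariant_in[OF g(1) hole_seq_in]] by blast
    obtain c where c: "skeleton n c (h hole_seq)"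
      using ex_skeleton[OF equivariant_in[OF h(1) hole_seq_in]] by blast
    have u: "skeleton n (a + b) u"
      unfolding u_def by (rule skeleton_equivariant[OF f(1,2) _ a b]) (simp add: equivariant_in g(1))
    have "skeleton n (b + a) v"
      unfolding v_def by (rule skeleton_equivariant[OF g(1,2) _ b a]) (simp add: equivariant_in f(1))
    then have "skeleton n (c + (b + a)) hole_seq"
      using skeleton_equivariant[OF h uv(2) c] hv by simp
    then obtain N where "\<And>k. agree N hole_seq (shift_pow k hole_seq) \<Longrightarrow> 5 ^ n dvd c + (b + a) + k"
      using skeleton_agree by blast
    \<comment> \<open>\<open>hole_seq\<close> agrees with itself, so \<open>k = 0\<close> is
      admissible and the total phase is zero modulo \<open>5 ^ n\<close>.\<close>
    from this[of 0] have "5 ^ n dvd c + (a + b)" by (simp add: agree_def add_ac)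
    then obtain m where m: "c + (a + b) = m * 5 ^ n" by (metis dvdE mult.commute)
    have hu: "skeleton n (c + (a + b)) (h u)"
      using skeleton_equivariant[OF h uv(1) c u] .
    show ?thesis
      unfolding skeleton_def
    proof (intro allI impI)
      fix i assume i: "per_at n i"
      \<comment> \<open>Moving by \<open>- m * 5 ^ n\<close> stays within the periodic positions and
        cancels the offset exactly.\<close>
      have "h u (i + (- m) * 5 ^ n + (c + (a + b))) = hole_seq (i + (- m) * 5 ^ n)"
        using hu per_at_shift[OF i] unfolding skeleton_def by blast
      then show "h u (i + 0) = hole_seq i" using per_at_shift[OF i, of "- m"] m by simp
    qed
  qed
  then have "h u = hole_seq" by (rule skeleton_determines)
  then have "h u = h v" using hv by simp
  moreover have "g (f (h w)) = w" if "w \<in> hole_shift" for w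
    using that by (simp add: h_def f(6) g(6) equivariant_in[OF g(3)])
  ultimately have "u = v" using uv by metis
  then show ?thesis
    using equivariant_eqI[OF equivariant_comp[OF f(1) g(1)] window_continuous_comp[OF f(2) g(1,2)]
      equivariant_comp[OF g(1) f(1)] window_continuous_comp[OF g(2) f(1,2)] _ y]
    unfolding u_def v_def by blast
qed

text \<open>Commuting with the shift extends to negative powers by cancelling one shift, and the
  inverse of a commuting bijection commutes as well.\<close>

lemma shift_automorphisms_iff:
  "f \<in> shift_automorphisms {0, 1} hole_shift \<longleftrightarrow>
    f \<in> extensional hole_shift \<and> (\<exists>g. dynamical_inverse f g)"
proof -
  define T where "T = subtopology (full_shift {0, 1 :: nat}) hole_shift"
  have top: "topspace T = hole_shift"
    using hole_shift_topspace by (auto simp: T_def)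
  have cont: "continuous_map T T f \<longleftrightarrow> f \<in> hole_shift \<rightarrow> hole_shift \<and> window_continuous f" for f
    unfolding T_def window_continuous_def using continuous_map_full_shift[OF hole_shift_topspace] .
  have eqv: "equivariant f" if f: "f \<in> hole_shift \<rightarrow> hole_shift" "\<forall>x\<in>hole_shift. f (shift x) = shift (f x)" for f
  proof -
    have "f (shift_pow k y) = shift_pow k (f y)" if y: "y \<in> hole_shift" for k y
    proof (induction k rule: int_induct[where k = 0])
      case base
      show ?case by simp
    next
      case (step1 i)
      have "f (shift (shift_pow i y)) = shift (f (shift_pow i y))"
        using f(2) y by simp
      moreover have "shift (shift_pow i z) = shift_pow (i + 1) z" for z :: "int \<Rightarrow> nat"
        by (simp add: add.commute flip: shift_pow_1)
      ultimately show ?case using step1 by metis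
    next
      case (step2 i)
      have "f (shift (shift_pow (i - 1) y)) = shift (f (shift_pow (i - 1) y))"
        using f(2) y by simp
      then have "shift_pow (-1) (f (shift_pow i y)) = f (shift_pow (i - 1) y)"
        by (simp flip: shift_pow_1)
      moreover have "shift_pow (-1) (shift_pow i (f y)) = shift_pow (i - 1) (f y)" by simp
      ultimately show ?case using step2 by metis
    qed
    then show ?thesis using f(1) by (simp add: equivariant_def)
  qed
  have comm: "f (shift x) = shift (f x)" if "equivariant f" "x \<in> hole_shift" for f x
    using equivariant_shift_pow[OF that, of 1] by (simp add: shift_pow_1)
  show ?thesis
  proof
    assume f: "f \<in> shift_automorphisms {0, 1} hole_shift"
    then obtain g where "homeomorphic_maps T T f g"
      unfolding shift_automorphisms_def homeomorphic_map_maps T_def by blast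
    then have g: "f \<in> hole_shift \<rightarrow> hole_shift" "window_continuous f" "g \<in> hole_shift \<rightarrow> hole_shift"
      "window_continuous g" "\<forall>y\<in>hole_shift. g (f y) = y \<and> f (g y) = y"
      unfolding homeomorphic_maps_def cont top by blast+
    have fc: "\<forall>x\<in>hole_shift. f (shift x) = shift (f x)"
      using f unfolding shift_automorphisms_def by blast
    have "g (shift x) = shift (g x)" if x: "x \<in> hole_shift" for x
    proof -
      have gx: "g x \<in> hole_shift" using g(3) x by blast
      have "shift x = f (shift (g x))" using fc gx g(5) x by simp
      then show ?thesis using g(5) shift_pow_in[OF gx, of 1] by (simp add: shift_pow_1)
    qed
    then have "dynamical_inverse f g"
      unfolding dynamical_inverse_def using g eqv fc by blast
    then show "f \<in> extensional hole_shift \<and> (\<exists>g. dynamical_inverse f g)"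
      using f unfolding shift_automorphisms_def by blast
  next
    assume f: "f \<in> extensional hole_shift \<and> (\<exists>g. dynamical_inverse f g)"
    then obtain g where g: "dynamical_inverse f g" by blast
    have "homeomorphic_maps T T f g"
      using g unfolding homeomorphic_maps_def cont top dynamical_inverse_def equivariant_def by blast
    then have "homeomorphic_map T T f" unfolding homeomorphic_map_maps by blast
    then show "f \<in> shift_automorphisms {0, 1} hole_shift"
      using f g comm unfolding shift_automorphisms_def T_def dynamical_inverse_def by blast
  qed
qed

section \<open>The automorphism group\<close>

definition hole_aut :: "((int \<Rightarrow> nat) \<Rightarrow> int \<Rightarrow> nat) monoid"
  where "hole_aut = shift_aut_group {0, 1} hole_shift"

definition shift_aut :: "int \<Rightarrow> (int \<Rightarrow> nat) \<Rightarrow> int \<Rightarrow> nat"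
  where "shift_aut k = restrict (shift_pow k) hole_shift"

lemma carrier_hole_aut: "carrier hole_aut = shift_automorphisms {0, 1} hole_shift"
  by (simp add: hole_aut_def shift_aut_group_def)

lemma hole_autE:
  assumes "f \<in> carrier hole_aut"
  obtains f' where "f \<in> extensional hole_shift" "dynamical_inverse f f'"
  using assms unfolding carrier_hole_aut shift_automorphisms_iff by blast

lemma hole_aut_equivariant: "f \<in> carrier hole_aut \<Longrightarrow> equivariant f"
  by (erule hole_autE) (simp add: dynamical_inverse_def)

lemma mult_hole_aut:
  assumes "f \<in> carrier hole_aut" "g \<in> carrier hole_aut"
  shows "f \<otimes>\<^bsub>hole_aut\<^esub> g = compose hole_shift f g"
proof -
  have "shift_automorphisms {0, 1} hole_shift \<subseteq> Bij hole_shift"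
    using subgroup.subset[OF subgroup_shift_automorphisms[OF subshift_hole_shift]]
    by (simp add: BijGroup_def)
  then show ?thesis
    using assms unfolding carrier_hole_aut by (auto simp: hole_aut_def shift_aut_group_def BijGroup_def)
qed

lemma one_hole_aut: "\<one>\<^bsub>hole_aut\<^esub> = shift_aut 0"
  by (auto simp: hole_aut_def shift_aut_group_def BijGroup_def shift_aut_def)

lemma comm_group_hole_aut: "comm_group hole_aut"
proof (rule group.group_comm_groupI)
  show "group hole_aut" unfolding hole_aut_def by (rule group_shift_aut_group[OF subshift_hole_shift])
  fix f g assume fg: "f \<in> carrier hole_aut" "g \<in> carrier hole_aut"
  have "f (g y) = g (f y)" if "y \<in> hole_shift" for y
    using fg that automorphisms_commute by (metis hole_autE)
  then show "f \<otimes>\<^bsub>hole_aut\<^esub> g = g \<otimes>\<^bsub>hole_aut\<^esub> f"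
    unfolding mult_hole_aut[OF fg] mult_hole_aut[OF fg(2,1)] compose_def by auto
qed

lemma shift_aut_in: "shift_aut k \<in> carrier hole_aut"
proof -
  have "equivariant (shift_aut k)" for k
    by (simp add: shift_aut_def equivariant_def add.commute)
  moreover have "window_continuous (shift_aut k)" for k
    unfolding window_continuous_def shift_aut_def using agree_shift_pow by fastforce
  moreover have "shift_aut (- k) (shift_aut k y) = y" "shift_aut k (shift_aut (- k) y) = y" if "y \<in> hole_shift" for y
    using that by (simp_all add: shift_aut_def)
  ultimately have "dynamical_inverse (shift_aut k) (shift_aut (- k))"
    unfolding dynamical_inverse_def by blast
  then show ?thesis
    unfolding carrier_hole_aut shift_automorphisms_iff by (auto simp: shift_aut_def)
qed

lemma shift_aut_mult: "shift_aut k \<otimes>\<^bsub>hole_aut\<^esub> shift_aut l = shift_aut (k + l)"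
  unfolding mult_hole_aut[OF shift_aut_in shift_aut_in] by (auto simp: shift_aut_def compose_def)

text \<open>Aperiodicity of \<open>hole_seq\<close> gives the shift infinite order, so that
  equations between its powers become equations between integers.\<close>

lemma shift_aut_inj: "shift_aut k = shift_aut l \<longleftrightarrow> k = l"
proof
  assume "shift_aut k = shift_aut l"
  then have "shift_pow k hole_seq = shift_pow l hole_seq"
    by (metis shift_aut_def restrict_apply' hole_seq_in)
  then have "hole_seq (i + k) = hole_seq (i + l)" for i
    by (metis shift_pow_apply)
  from this[of "_ - l"] have "hole_seq (i + (k - l)) = hole_seq i" for i
    by (simp add: algebra_simps)
  then show "k = l" using hole_seq_aperiodic by fastforce
qed simp

lemma shift_aut_pow: "shift_aut k [^]\<^bsub>hole_aut\<^esub> (n::nat) = shift_aut (k * int n)"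
proof -
  interpret comm_group hole_aut by (rule comm_group_hole_aut)
  show ?thesis
    by (induction n) (simp_all add: one_hole_aut shift_aut_mult algebra_simps)
qed

lemma subgroup_shift_aut: "subgroup (range shift_aut) hole_aut"
proof -
  interpret comm_group hole_aut by (rule comm_group_hole_aut)
  have "inv\<^bsub>hole_aut\<^esub> (shift_aut k) = shift_aut (- k)" for k
    by (rule inv_equality) (simp_all add: shift_aut_mult shift_aut_in one_hole_aut)
  then show ?thesis
    by (intro subgroupI) (auto simp: shift_aut_in shift_aut_mult)
qed

section \<open>Roots of powers of the shift and the failure of finite generation\<close>

lemma dynamical_inverse_lift:
  assumes "dynamical_inverse f g"
  shows "dynamical_inverse (lift f) (lift g)"
proof -
  have fg: "equivariant f" "window_continuous f" "equivariant g" "window_continuous g"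
    "\<And>y. y \<in> hole_shift \<Longrightarrow> g (f y) = y" "\<And>y. y \<in> hole_shift \<Longrightarrow> f (g y) = y"
    using assms by (simp_all add: dynamical_inverse_def)
  have "lift g (lift f y) = y \<and> lift f (lift g y) = y" if y: "y \<in> hole_shift" for y
  proof -
    obtain c z where "z \<in> hole_shift" "y = shift_pow c (fill z)" using hole_shift_cases[OF y] .
    then show ?thesis using fg by (simp add: lift_fill equivariant_in)
  qed
  then show ?thesis
    unfolding dynamical_inverse_def
    using equivariant_lift window_continuous_lift fg by blast
qed

lemma lift_hom: "lift \<in> hom hole_aut hole_aut"
proof -
  have in_carrier: "lift f \<in> carrier hole_aut" if f: "f \<in> carrier hole_aut" for f
  proof -
    obtain f' where "dynamical_inverse f f'" using hole_autE[OF f] by blast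
    then have "dynamical_inverse (lift f) (lift f')" by (rule dynamical_inverse_lift)
    then show ?thesis
      unfolding carrier_hole_aut shift_automorphisms_iff by (auto simp: lift_def)
  qed
  have "lift (f \<otimes>\<^bsub>hole_aut\<^esub> g) = lift f \<otimes>\<^bsub>hole_aut\<^esub> lift g"
    if fg: "f \<in> carrier hole_aut" "g \<in> carrier hole_aut" for f g
  proof -
    interpret comm_group hole_aut by (rule comm_group_hole_aut)
    have "lift (f \<otimes>\<^bsub>hole_aut\<^esub> g) y = lift f (lift g y)" if "y \<in> hole_shift" for y
      using lift_comp[OF hole_aut_equivariant[OF fg(1)] hole_aut_equivariant[OF fg(2)]
        hole_aut_equivariant[OF m_closed[OF fg]] _ that]
      by (simp add: mult_hole_aut[OF fg] compose_def)
    then show ?thesis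
      unfolding mult_hole_aut[OF in_carrier in_carrier, OF fg]
      by (auto simp: fun_eq_iff compose_def lift_def)
  qed
  then show ?thesis using in_carrier by (simp add: hom_def)
qed

lemma lift_shift_aut: "lift (shift_aut (2 * k)) = shift_aut (5 * k)"
  unfolding shift_aut_def by (rule lift_restrict_shift_pow)

text \<open>By \<open>shift_root_pow\<close> this behaves like the power of the shift with exponent
  \<open>(5/2) ^ n\<close>.\<close>

definition shift_root :: "nat \<Rightarrow> (int \<Rightarrow> nat) \<Rightarrow> int \<Rightarrow> nat"
  where "shift_root n = (lift ^^ n) (shift_aut 1)"

lemma shift_root_in: "shift_root n \<in> carrier hole_aut"
  by (induction n) (use shift_aut_in lift_hom in \<open>auto simp: shift_root_def hom_def\<close>)

lemma shift_root_pow: "shift_root n [^]\<^bsub>hole_aut\<^esub> ((2::nat) ^ n) = shift_aut (5 ^ n)"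
proof (induction n)
  case 0
  show ?case using shift_aut_pow[of 1 1] by (simp add: shift_root_def)
next
  case (Suc n)
  interpret comm_group hole_aut by (rule comm_group_hole_aut)
  interpret lift: group_hom hole_aut hole_aut lift
    by unfold_locales (rule lift_hom)
  have "shift_root (Suc n) [^]\<^bsub>hole_aut\<^esub> ((2::nat) ^ Suc n) =
      lift (shift_root n) [^]\<^bsub>hole_aut\<^esub> ((2::nat) ^ n * 2)"
    by (simp add: shift_root_def mult.commute)
  \<comment> \<open>The exponent is moved inside \<open>lift\<close>, with the squaring last: this
    produces the even shift that \<open>lift_shift_aut\<close> needs.\<close>
  also have "\<dots> = lift ((shift_root n [^]\<^bsub>hole_aut\<^esub> ((2::nat) ^ n)) [^]\<^bsub>hole_aut\<^esub> (2::nat))"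
    by (simp add: lift.hom_nat_pow nat_pow_pow shift_root_in)
  also have "\<dots> = lift (shift_aut (2 * 5 ^ n))"
    unfolding Suc.IH shift_aut_pow by (simp add: mult.commute)
  also have "\<dots> = shift_aut (5 ^ Suc n)" by (simp add: lift_shift_aut)
  finally show ?case .
qed

text \<open>Finite generation would give one exponent \<open>M\<close> for all elements of finite
  order modulo the powers of the shift. The root of index \<open>M\<close> violates it, because
  \<open>M < 2 ^ M\<close>.\<close>

lemma not_finitely_generated_hole_aut: "\<not> finitely_generated_group hole_aut"
proof
  assume "finitely_generated_group hole_aut"
  then obtain A where A: "finite A" "A \<subseteq> carrier hole_aut" "generate hole_aut A = carrier hole_aut"
    unfolding finitely_generated_group_def by blast
  interpret comm_group hole_aut by (rule comm_group_hole_aut)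
  have gen: "carrier hole_aut \<subseteq> generate hole_aut (A \<union> range shift_aut)"
    using mono_generate[of A "A \<union> range shift_aut"] A(3) by blast
  obtain M :: nat where M: "M > 0" "\<And>g n. g \<in> generate hole_aut (A \<union> range shift_aut) \<Longrightarrow> n > 0 \<Longrightarrow>
      g [^]\<^bsub>hole_aut\<^esub> (n::nat) \<in> range shift_aut \<Longrightarrow> g [^]\<^bsub>hole_aut\<^esub> M \<in> range shift_aut"
    using bounded_exponent_modulo_subgroup[OF A(1,2) subgroup_shift_aut] by blast
  have "shift_root M [^]\<^bsub>hole_aut\<^esub> M \<in> range shift_aut"
  proof (rule M(2))
    show "shift_root M \<in> generate hole_aut (A \<union> range shift_aut)" using gen shift_root_in by blast
    show "shift_root M [^]\<^bsub>hole_aut\<^esub> ((2::nat) ^ M) \<in> range shift_aut" unfolding shift_root_pow by blast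
  qed simp
  then obtain k where k: "shift_root M [^]\<^bsub>hole_aut\<^esub> M = shift_aut k" by blast
  \<comment> \<open>The power with exponent \<open>M * 2 ^ M\<close> is computed in two ways;
    comparing exponents shows that \<open>2 ^ M\<close> divides \<open>M\<close>, since it is
    coprime to \<open>5 ^ M\<close>.\<close>
  have "shift_aut (5 ^ M * int M) = (shift_root M [^]\<^bsub>hole_aut\<^esub> ((2::nat) ^ M)) [^]\<^bsub>hole_aut\<^esub> M"
    by (simp add: shift_root_pow shift_aut_pow)
  also have "\<dots> = (shift_root M [^]\<^bsub>hole_aut\<^esub> M) [^]\<^bsub>hole_aut\<^esub> ((2::nat) ^ M)"
    by (simp only: nat_pow_pow[OF shift_root_in] mult.commute)
  also have "\<dots> = shift_aut (k * 2 ^ M)" by (simp add: k shift_aut_pow)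
  finally have "5 ^ M * int M = k * 2 ^ M" by (simp only: shift_aut_inj)
  then have "2 ^ M dvd 5 ^ M * int M" by simp
  moreover have "coprime ((2::int) ^ M) (5 ^ M)" by simp
  ultimately have "2 ^ M dvd int M" by (simp add: coprime_dvd_mult_right_iff)
  then have "2 ^ M \<le> int M" by (rule zdvd_imp_le) (use M(1) in simp)
  then show False using of_nat_less_two_power[of M, where 'a = int] by linarith
qed

theorem corollary1:
  shows "\<exists>(S :: nat set) X. finite S \<and> toeplitz_subshift S X \<and> minimal_subshift S X \<and>
           \<not> finitely_generated_group (shift_aut_group S X)"
  using toeplitz_hole_shift minimal_hole_shift not_finitely_generated_hole_aut[unfolded hole_aut_def]
  by (intro exI[of _ "{0, 1}"] exI[of _ hole_shift]) simp

end
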